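(* The $\mathbb{R}$-bilinear product on $aff(\mathbb{R}^n)=\mathbb{R}^n\rtimes_{id}gl(\mathbb{R}^n)$ given by $$(a,f)\cdot (b,g)=(f(b),f\circ g)$$ is associative and compatible with the Lie bracket of $aff(\mathbb{R}^n)$ (that is, $u\cdot v-v\cdot u=[u,v]$). Hence it defines a flat bi-invariant affine structure $\widetilde{\nabla}$ on the group $Aff(\mathbb{R}^n,\nabla^0)$. Moreover, if $\circ$ denotes the linear connection on $GL(\mathbb{R}^n)$ determined by composition of linear endomorphisms, then the canonical sequence $$0\longrightarrow (\mathbb{R}^n,\nabla^0)\longrightarrow (Aff(\mathbb{R}^n,\nabla^0),\widetilde{\nabla})\longrightarrow (GL(\mathbb{R}^n),\circ)\longrightarrow 1$$ is a split exact sequence of flat bi-invariant affine Lie groups.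
   Context: $\nabla^0$ is the standard flat connection of $\mathbb{R}^n$ and $Aff(\mathbb{R}^n,\nabla^0)=\mathbb{R}^n\rtimes GL(\mathbb{R}^n)$ is the classical affine group, with Lie algebra $aff(\mathbb{R}^n)=\mathbb{R}^n\rtimes_{id}gl(\mathbb{R}^n)$. A flat affine structure on a manifold is a flat torsion free linear connection. On a Lie group $G$ with Lie algebra $\mathfrak{g}$, a bilinear product $\cdot$ on $\mathfrak{g}$ determines a left invariant linear connection by $\nabla_{x^+}y^+=(x\cdot y)^+$, where $x^+$ is the left invariant vector field determined by $x\in\mathfrak{g}$. The structure is bi-invariant if it is preserved by all left and all right translations. The connection $\circ$ on $GL(\mathbb{R}^n)$ is the one given by the product $f\circ g$ on $gl(\mathbb{R}^n)$. A (split) exact sequence of flat bi-invariant affine Lie groups is a (split) exact sequence of Lie groups, each carrying a flat bi-invariant affine structure, whose homomorphisms (including the section) are affine maps, i.e. compatible with the connections. *)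

theory Defs
  imports "HOL-Analysis.Analysis" "HOL-Algebra.Coset"
begin

text \<open>
  All manifolds considered here are open subsets \<open>U\<close> of a Euclidean space \<open>'a\<close>, equipped with the
  identity chart; every tangent space is identified with \<open>'a\<close>. Maps and vector fields are total
  functions, of which only the values on \<open>U\<close> matter.
\<close>

section \<open>Smooth maps and vector fields\<close>

text \<open>
  For open \<open>U\<close> in a finite-dimensional space, \<open>C\<^sup>k\<close> is expressed by directional derivatives.
\<close>

primrec Ck_on :: "nat \<Rightarrow> 'a::euclidean_space set \<Rightarrow> ('a \<Rightarrow> 'b::real_normed_vector) \<Rightarrow> bool" where
  "Ck_on 0 U f \<longleftrightarrow> continuous_on U f"
| "Ck_on (Suc k) U f \<longleftrightarrow>
     (\<forall>p\<in>U. f differentiable (at p)) \<and> (\<forall>v. Ck_on k U (\<lambda>p. frechet_derivative f (at p) v))"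

definition smooth_on :: "'a::euclidean_space set \<Rightarrow> ('a \<Rightarrow> 'b::real_normed_vector) \<Rightarrow> bool" where
  "smooth_on U f \<longleftrightarrow> (\<forall>k. Ck_on k U f)"

definition vf_bracket ::
    "('a::euclidean_space \<Rightarrow> 'a) \<Rightarrow> ('a \<Rightarrow> 'a) \<Rightarrow> 'a \<Rightarrow> 'a" where
  "vf_bracket X Y p = frechet_derivative Y (at p) (X p) - frechet_derivative X (at p) (Y p)"

section \<open>Linear connections\<close>

type_synonym 'a connection = "('a \<Rightarrow> 'a) \<Rightarrow> ('a \<Rightarrow> 'a) \<Rightarrow> 'a \<Rightarrow> 'a"

text \<open>\<open>D X Y\<close> is the covariant derivative of \<open>Y\<close> in the direction of \<open>X\<close>.\<close>

definition linear_connection :: "'a::euclidean_space set \<Rightarrow> 'a connection \<Rightarrow> bool" where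
  "linear_connection U D \<longleftrightarrow>
     (\<forall>X Y. smooth_on U X \<longrightarrow> smooth_on U Y \<longrightarrow> smooth_on U (D X Y)) \<and>
     (\<forall>X X' Y. smooth_on U X \<longrightarrow> smooth_on U X' \<longrightarrow> smooth_on U Y \<longrightarrow>
        (\<forall>p\<in>U. D (\<lambda>q. X q + X' q) Y p = D X Y p + D X' Y p)) \<and>
     (\<forall>X Y Y'. smooth_on U X \<longrightarrow> smooth_on U Y \<longrightarrow> smooth_on U Y' \<longrightarrow>
        (\<forall>p\<in>U. D X (\<lambda>q. Y q + Y' q) p = D X Y p + D X Y' p)) \<and>
     (\<forall>(f::'a \<Rightarrow> real) X Y. smooth_on U f \<longrightarrow> smooth_on U X \<longrightarrow> smooth_on U Y \<longrightarrow>
        (\<forall>p\<in>U. D (\<lambda>q. f q *\<^sub>R X q) Y p = f p *\<^sub>R D X Y p)) \<and>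
     (\<forall>(f::'a \<Rightarrow> real) X Y. smooth_on U f \<longrightarrow> smooth_on U X \<longrightarrow> smooth_on U Y \<longrightarrow>
        (\<forall>p\<in>U. D X (\<lambda>q. f q *\<^sub>R Y q) p =
                 frechet_derivative f (at p) (X p) *\<^sub>R Y p + f p *\<^sub>R D X Y p))"

definition torsion_free :: "'a::euclidean_space set \<Rightarrow> 'a connection \<Rightarrow> bool" where
  "torsion_free U D \<longleftrightarrow>
     (\<forall>X Y. smooth_on U X \<longrightarrow> smooth_on U Y \<longrightarrow>
        (\<forall>p\<in>U. D X Y p - D Y X p = vf_bracket X Y p))"

definition flat :: "'a::euclidean_space set \<Rightarrow> 'a connection \<Rightarrow> bool" where
  "flat U D \<longleftrightarrow>
     (\<forall>X Y Z. smooth_on U X \<longrightarrow> smooth_on U Y \<longrightarrow> smooth_on U Z \<longrightarrow>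
        (\<forall>p\<in>U. D X (D Y Z) p - D Y (D X Z) p - D (vf_bracket X Y) Z p = 0))"

definition flat_affine_structure :: "'a::euclidean_space set \<Rightarrow> 'a connection \<Rightarrow> bool" where
  "flat_affine_structure U D \<longleftrightarrow> linear_connection U D \<and> flat U D \<and> torsion_free U D"

definition std_connection :: "'a::euclidean_space connection" where
  "std_connection X Y p = frechet_derivative Y (at p) (X p)"

text \<open>Christoffel symbols with respect to the frame of constant vector fields.\<close>

definition christoffel :: "'a::euclidean_space connection \<Rightarrow> 'a \<Rightarrow> 'a \<Rightarrow> 'a \<Rightarrow> 'a" where
  "christoffel D p v w = D (\<lambda>_. v) (\<lambda>_. w) p"

text \<open>
  The pullback connection along \<open>F\<close>: covariant derivative, in the direction of a vector field \<open>X\<close> on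
  the source, of a vector field \<open>V\<close> along \<open>F\<close> (so \<open>V p\<close> is tangent to the target at \<open>F p\<close>).
\<close>

definition pullback_connection ::
    "'b::euclidean_space connection \<Rightarrow> ('a::euclidean_space \<Rightarrow> 'b) \<Rightarrow>
     ('a \<Rightarrow> 'a) \<Rightarrow> ('a \<Rightarrow> 'b) \<Rightarrow> 'a \<Rightarrow> 'b" where
  "pullback_connection D' F X V p =
     frechet_derivative V (at p) (X p) +
     christoffel D' (F p) (frechet_derivative F (at p) (X p)) (V p)"

text \<open>
  A map is affine if \<open>dF (D\<^sub>X Y) = (F\<^sup>* D')\<^sub>X (dF Y)\<close> for all vector fields \<open>X\<close>, \<open>Y\<close>. If \<open>F\<close> is a
  diffeomorphism, this says that \<open>F\<close> transports \<open>D\<close> to \<open>D'\<close>.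
\<close>

definition affine_map ::
    "'a::euclidean_space set \<Rightarrow> 'a connection \<Rightarrow> 'b::euclidean_space set \<Rightarrow> 'b connection \<Rightarrow>
     ('a \<Rightarrow> 'b) \<Rightarrow> bool" where
  "affine_map U D V D' F \<longleftrightarrow>
     smooth_on U F \<and> F ` U \<subseteq> V \<and>
     (\<forall>X Y. smooth_on U X \<longrightarrow> smooth_on U Y \<longrightarrow>
        (\<forall>p\<in>U. frechet_derivative F (at p) (D X Y p) =
           pullback_connection D' F X (\<lambda>q. frechet_derivative F (at q) (Y q)) p))"

section \<open>Lie groups\<close>

definition lie_group :: "'a::euclidean_space monoid \<Rightarrow> bool" where
  "lie_group G \<longleftrightarrow>
     group G \<and> open (carrier G) \<and>
     smooth_on (carrier G \<times> carrier G) (\<lambda>(g, h). g \<otimes>\<^bsub>G\<^esub> h) \<and>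
     smooth_on (carrier G) (\<lambda>g. inv\<^bsub>G\<^esub> g)"

text \<open>The Lie algebra, i.e. the tangent space at the unit, is \<open>'a\<close>.\<close>

definition left_inv_field :: "'a::euclidean_space monoid \<Rightarrow> 'a \<Rightarrow> 'a \<Rightarrow> 'a" where
  "left_inv_field G x g = frechet_derivative (\<lambda>h. g \<otimes>\<^bsub>G\<^esub> h) (at \<one>\<^bsub>G\<^esub>) x"

definition lie_algebra_bracket :: "'a::euclidean_space monoid \<Rightarrow> 'a \<Rightarrow> 'a \<Rightarrow> 'a" where
  "lie_algebra_bracket G x y = vf_bracket (left_inv_field G x) (left_inv_field G y) \<one>\<^bsub>G\<^esub>"

text \<open>
  \<open>D\<close> is the left invariant connection determined by the bilinear product \<open>P\<close> on the Lie algebra.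
  This fixes \<open>D\<close> on vector fields that are smooth on \<open>carrier G\<close>, at the points of \<open>carrier G\<close>.
\<close>

definition determined_by_product ::
    "'a::euclidean_space monoid \<Rightarrow> ('a \<Rightarrow> 'a \<Rightarrow> 'a) \<Rightarrow> 'a connection \<Rightarrow> bool" where
  "determined_by_product G P D \<longleftrightarrow>
     linear_connection (carrier G) D \<and>
     (\<forall>x y. \<forall>g\<in>carrier G.
        D (left_inv_field G x) (left_inv_field G y) g = left_inv_field G (P x y) g)"

definition bi_invariant :: "'a::euclidean_space monoid \<Rightarrow> 'a connection \<Rightarrow> bool" where
  "bi_invariant G D \<longleftrightarrow>
     (\<forall>g\<in>carrier G.
        affine_map (carrier G) D (carrier G) D (\<lambda>h. g \<otimes>\<^bsub>G\<^esub> h) \<and>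
        affine_map (carrier G) D (carrier G) D (\<lambda>h. h \<otimes>\<^bsub>G\<^esub> g))"

definition flat_bi_invariant_affine_lie_group ::
    "'a::euclidean_space monoid \<Rightarrow> 'a connection \<Rightarrow> bool" where
  "flat_bi_invariant_affine_lie_group G D \<longleftrightarrow>
     lie_group G \<and> flat_affine_structure (carrier G) D \<and> bi_invariant G D"

definition affine_hom ::
    "'a::euclidean_space monoid \<Rightarrow> 'a connection \<Rightarrow> 'b::euclidean_space monoid \<Rightarrow> 'b connection \<Rightarrow>
     ('a \<Rightarrow> 'b) \<Rightarrow> bool" where
  "affine_hom G D H D' F \<longleftrightarrow> F \<in> hom G H \<and> affine_map (carrier G) D (carrier H) D' F"

definition split_exact_affine ::
    "'a::euclidean_space monoid \<Rightarrow> 'a connection \<Rightarrow> ('a \<Rightarrow> 'b) \<Rightarrow>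
     'b::euclidean_space monoid \<Rightarrow> 'b connection \<Rightarrow> ('b \<Rightarrow> 'c) \<Rightarrow>
     'c::euclidean_space monoid \<Rightarrow> 'c connection \<Rightarrow> bool" where
  "split_exact_affine N DN i G DG q Q DQ \<longleftrightarrow>
     flat_bi_invariant_affine_lie_group N DN \<and>
     flat_bi_invariant_affine_lie_group G DG \<and>
     flat_bi_invariant_affine_lie_group Q DQ \<and>
     affine_hom N DN G DG i \<and> affine_hom G DG Q DQ q \<and>
     inj_on i (carrier N) \<and> i ` carrier N = kernel G Q q \<and> q ` carrier G = carrier Q \<and>
     (\<exists>s. affine_hom Q DQ G DG s \<and> (\<forall>x\<in>carrier Q. q (s x) = x))"

section \<open>The affine group\<close>

text \<open>
  Linear endomorphisms of \<open>\<real>\<^sup>n\<close> are represented by their matrices; composition is \<open>(**)\<close> and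
  evaluation is \<open>(*v)\<close>.
\<close>

type_synonym 'n gl = "real ^ 'n ^ 'n"
type_synonym 'n aff = "(real ^ 'n) \<times> (real ^ 'n ^ 'n)"

definition vector_group :: "(real ^ 'n) monoid" where
  "vector_group = \<lparr>carrier = UNIV, mult = (+), one = 0\<rparr>"

definition GL_group :: "('n::finite) gl monoid" where
  "GL_group = \<lparr>carrier = {A. invertible A}, mult = (**), one = mat 1\<rparr>"

definition Aff_group :: "('n::finite) aff monoid" where
  "Aff_group =
     \<lparr>carrier = {(a, A). invertible A},
      mult = (\<lambda>(a, A) (b, B). (a + A *v b, A ** B)),
      one = (0, mat 1)\<rparr>"

text \<open>The bracket of the semidirect product of Lie algebras \<open>\<real>\<^sup>n \<rtimes>\<^bsub>id\<^esub> gl(\<real>\<^sup>n)\<close>.\<close>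

definition aff_bracket :: "('n::finite) aff \<Rightarrow> 'n aff \<Rightarrow> 'n aff" where
  "aff_bracket = (\<lambda>(a, f) (b, g). (f *v b - g *v a, f ** g - g ** f))"

definition aff_product :: "('n::finite) aff \<Rightarrow> 'n aff \<Rightarrow> 'n aff" where
  "aff_product = (\<lambda>(a, f) (b, g). (f *v b, f ** g))"

definition aff_incl :: "real ^ 'n \<Rightarrow> ('n::finite) aff" where
  "aff_incl a = (a, mat 1)"

definition aff_proj :: "('n::finite) aff \<Rightarrow> 'n gl" where
  "aff_proj = snd"

end

theory Submission
  imports Defs
begin

text \<open>
  In the matrix chart the theorem reduces to a statement about one connection, the standard one.
  For \<open>G = GL(\<real>\<^sup>n)\<close> and for the affine group, let \<open>P\<close> be the given associative product on the Lie
  algebra. The left translation by \<open>g\<close> is \<open>h \<mapsto> c + P g h\<close> with \<open>c\<close> independent of \<open>h\<close>, so the left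
  invariant field of \<open>x\<close> is \<open>g \<mapsto> P g x\<close>, which is linear in \<open>g\<close>. The derivative of \<open>P g y\<close> in the
  direction \<open>P g x\<close> is therefore \<open>P (P g x) y = P g (P x y)\<close>: the ordinary directional derivative is a
  connection determined by \<open>P\<close>. For the same reason the Lie algebra bracket is the commutator of \<open>P\<close>.

  Conversely every connection determined by \<open>P\<close> is the standard one on smooth fields. The difference
  of two connections is linear over smooth functions in both arguments; it vanishes on left
  invariant fields, and these span all smooth fields with smooth coefficients because
  \<open>X q = P q (P q\<inverse> (X q))\<close>. Smoothness of the coefficients comes from smoothness of matrix inversion
  (lemmas \<open>smooth_on_matrix_inv\<close>, \<open>agrees_with_std_if_determined_by_product\<close>).

  For the standard connection, vanishing of the torsion is the formula for the bracket of vector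
  fields, vanishing of the curvature is the symmetry of second derivatives
  (\<open>second_derivative_symmetric\<close>), and every map of the form constant plus linear is affine
  (\<open>affine_map_if_agrees_with_std\<close>). Left and right translations, the inclusion of \<open>\<real>\<^sup>n\<close>, the
  projection to \<open>GL(\<real>\<^sup>n)\<close> and its section \<open>A \<mapsto> (0, A)\<close> all have this form, and exactness is immediate.
\<close>

section \<open>Calculus of smooth maps\<close>

lemma Ck_on_Suc_frechet_derivative:
  "Ck_on (Suc k) U f \<Longrightarrow> Ck_on k U (\<lambda>p. frechet_derivative f (at p) v)"
  by simp

lemma Ck_on_cong:
  assumes "open U" "\<And>p. p \<in> U \<Longrightarrow> f p = g p" "Ck_on k U f"
  shows "Ck_on k U g"
  using assms(2,3)
proof (induction k arbitrary: f g)
  case 0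
  then show ?case by (metis Ck_on.simps(1) continuous_on_cong)
next
  case (Suc k)
  have df: "f differentiable (at p)" if "p \<in> U" for p
    using Suc.prems(2) that by simp
  have dg: "g differentiable (at p)" if "p \<in> U" for p
    using df[OF that] Suc.prems(1) assms(1) that
    by (metis differentiable_def has_derivative_transform_within_open)
  have eq: "frechet_derivative f (at p) = frechet_derivative g (at p)" if "p \<in> U" for p
    using frechet_derivative_transform_within_open[OF df[OF that] assms(1) that] Suc.prems(1) by blast
  have "Ck_on k U (\<lambda>p. frechet_derivative g (at p) v)" for v
    by (rule Suc.IH[of "\<lambda>p. frechet_derivative f (at p) v", OF _ Ck_on_Suc_frechet_derivative[OF Suc.prems(2)]])
      (rule fun_cong[OF eq])
  with dg show ?case unfolding Ck_on.simps(2) by blast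
qed

lemma Ck_on_Suc_intro:
  assumes "open U" "\<And>p. p \<in> U \<Longrightarrow> (f has_derivative f' p) (at p)"
    and "\<And>v. Ck_on k U (\<lambda>p. f' p v)"
  shows "Ck_on (Suc k) U f"
proof -
  have "Ck_on k U (\<lambda>p. frechet_derivative f (at p) v)" for v
    by (rule Ck_on_cong[OF assms(1) _ assms(3)[of v]])
      (rule fun_cong[OF frechet_derivative_at[OF assms(2)]])
  moreover have "\<forall>p\<in>U. f differentiable (at p)"
    using assms(2) unfolding differentiable_def by blast
  ultimately show ?thesis unfolding Ck_on.simps(2) by blast
qed

lemma Ck_on_Suc_has_derivative:
  "Ck_on (Suc k) U f \<Longrightarrow> p \<in> U \<Longrightarrow> (f has_derivative frechet_derivative f (at p)) (at p)"
  unfolding Ck_on.simps(2) frechet_derivative_works[symmetric] by blast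

lemma Ck_on_SucD: "Ck_on (Suc k) U f \<Longrightarrow> Ck_on k U f"
proof (induction k arbitrary: f)
  case 0
  then show ?case
    by (auto intro!: continuous_at_imp_continuous_on differentiable_imp_continuous_within)
next
  case (Suc k)
  have "f differentiable (at p)" if "p \<in> U" for p
    using Suc.prems that by simp
  moreover have "Ck_on k U (\<lambda>p. frechet_derivative f (at p) v)" for v
    by (rule Suc.IH[OF Ck_on_Suc_frechet_derivative[OF Suc.prems]])
  ultimately show ?case unfolding Ck_on.simps(2) by blast
qed

lemma Ck_on_const:
  fixes U :: "'a::euclidean_space set" and c :: "'b::real_normed_vector"
  assumes "open U"
  shows "Ck_on k U (\<lambda>_. c)"
proof (induction k arbitrary: c)
  case 0
  show ?case unfolding Ck_on.simps(1) by (rule continuous_on_const)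
next
  case (Suc k)
  show ?case
  proof (rule Ck_on_Suc_intro[OF assms])
    show "((\<lambda>_. c) has_derivative (\<lambda>_. 0)) (at p)" for p :: 'a
      by (rule has_derivative_const)
    show "Ck_on k U (\<lambda>_. 0 :: 'b)" by (rule Suc)
  qed
qed

lemma Ck_on_bounded_linear:
  fixes L :: "'a::euclidean_space \<Rightarrow> 'b::real_normed_vector"
  assumes "open U" "bounded_linear L"
  shows "Ck_on k U L"
proof (cases k)
  case 0
  then show ?thesis using assms by (simp add: linear_continuous_on)
next
  case (Suc m)
  have "Ck_on (Suc m) U L"
  proof (rule Ck_on_Suc_intro[OF assms(1)])
    show "(L has_derivative L) (at p)" for p
      using assms(2) by (rule bounded_linear_imp_has_derivative)
    show "Ck_on m U (\<lambda>_. L v)" for v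
      using assms(1) by (rule Ck_on_const)
  qed
  then show ?thesis by (simp only: Suc)
qed

lemma Ck_on_add:
  assumes "open U" "Ck_on k U f" "Ck_on k U g"
  shows "Ck_on k U (\<lambda>p. f p + g p)"
  using assms(2,3)
proof (induction k arbitrary: f g)
  case 0
  then show ?case by (simp add: continuous_on_add)
next
  case (Suc k)
  show ?case
  proof (rule Ck_on_Suc_intro[OF assms(1)])
    fix p assume p: "p \<in> U"
    show "((\<lambda>p. f p + g p) has_derivative
        (\<lambda>v. frechet_derivative f (at p) v + frechet_derivative g (at p) v)) (at p)"
      using Suc.prems by (intro has_derivative_add Ck_on_Suc_has_derivative[OF _ p])
  next
    show "Ck_on k U (\<lambda>p. frechet_derivative f (at p) v + frechet_derivative g (at p) v)" for v
      by (rule Suc.IH; rule Ck_on_Suc_frechet_derivative; rule Suc.prems)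
  qed
qed

text \<open>
  The Leibniz rule expresses the derivative as a sum of two products of the same kind whose factors
  are \<open>C\<^sup>k\<close>. Hence the induction has to range over all pairs of maps.
\<close>

lemma (in bounded_bilinear) Ck_on_bilinear:
  assumes "open U" "Ck_on k U f" "Ck_on k U g"
  shows "Ck_on k U (\<lambda>p. prod (f p) (g p))"
  using assms(2,3)
proof (induction k arbitrary: f g)
  case 0
  then show ?case unfolding Ck_on.simps(1) by (rule continuous_on)
next
  case (Suc k)
  show ?case
  proof (rule Ck_on_Suc_intro[OF assms(1)])
    fix p assume p: "p \<in> U"
    show "((\<lambda>p. prod (f p) (g p)) has_derivative
        (\<lambda>v. prod (f p) (frechet_derivative g (at p) v) + prod (frechet_derivative f (at p) v) (g p))) (at p)"
      using Suc.prems by (intro FDERIV Ck_on_Suc_has_derivative[OF _ p])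
  next
    fix v
    show "Ck_on k U (\<lambda>p. prod (f p) (frechet_derivative g (at p) v) + prod (frechet_derivative f (at p) v) (g p))"
      by (rule Ck_on_add[OF assms(1) Suc.IH Suc.IH]; (rule Ck_on_Suc_frechet_derivative | rule Ck_on_SucD); rule Suc.prems)
  qed
qed

lemma Ck_on_bounded_linear_comp:
  assumes "open U" "bounded_linear L" "Ck_on k U f"
  shows "Ck_on k U (\<lambda>p. L (f p))"
  using assms(3)
proof (induction k arbitrary: f)
  case 0
  then show ?case unfolding Ck_on.simps(1) by (rule bounded_linear.continuous_on[OF assms(2)])
next
  case (Suc k)
  show ?case
  proof (rule Ck_on_Suc_intro[OF assms(1)])
    fix p assume p: "p \<in> U"
    show "((\<lambda>p. L (f p)) has_derivative (\<lambda>v. L (frechet_derivative f (at p) v))) (at p)"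
      by (rule bounded_linear.has_derivative[OF assms(2) Ck_on_Suc_has_derivative[OF Suc.prems p]])
  next
    show "Ck_on k U (\<lambda>p. L (frechet_derivative f (at p) v))" for v
      by (intro Suc.IH Ck_on_Suc_frechet_derivative Suc.prems)
  qed
qed

lemma Ck_on_comp_bounded_linear:
  assumes "open U" "open V" "bounded_linear L" "L ` U \<subseteq> V" "Ck_on k V f"
  shows "Ck_on k U (\<lambda>p. f (L p))"
  using assms(5)
proof (induction k arbitrary: f)
  case 0
  then show ?case using assms(3,4)
    by (metis Ck_on.simps(1) continuous_on_compose2 linear_continuous_on)
next
  case (Suc k)
  show ?case
  proof (rule Ck_on_Suc_intro[OF assms(1)])
    fix p assume p: "p \<in> U"
    then have "(f has_derivative frechet_derivative f (at (L p))) (at (L p))"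
      using Suc.prems assms(4) by (intro Ck_on_Suc_has_derivative) auto
    from diff_chain_at[OF bounded_linear_imp_has_derivative[OF assms(3)] this]
    show "((\<lambda>p. f (L p)) has_derivative (\<lambda>v. frechet_derivative f (at (L p)) (L v))) (at p)"
      by (simp add: o_def)
  next
    fix v
    show "Ck_on k U (\<lambda>p. frechet_derivative f (at (L p)) (L v))"
      by (rule Suc.IH[OF Ck_on_Suc_frechet_derivative[OF Suc.prems]])
  qed
qed

lemma smooth_onI: "(\<And>k. Ck_on k U f) \<Longrightarrow> smooth_on U f"
  by (simp add: smooth_on_def)

lemma smooth_onD: "smooth_on U f \<Longrightarrow> Ck_on k U f"
  by (simp add: smooth_on_def)

lemma smooth_on_const: "open U \<Longrightarrow> smooth_on U (\<lambda>_. c)"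
  by (rule smooth_onI, rule Ck_on_const)

lemma smooth_on_bounded_linear: "open U \<Longrightarrow> bounded_linear L \<Longrightarrow> smooth_on U L"
  by (rule smooth_onI, rule Ck_on_bounded_linear)

lemma smooth_on_cong:
  assumes "open U" "\<And>p. p \<in> U \<Longrightarrow> f p = g p" "smooth_on U f"
  shows "smooth_on U g"
  by (rule smooth_onI, rule Ck_on_cong[OF assms(1,2) smooth_onD[OF assms(3)]])

lemma smooth_on_add:
  assumes "open U" "smooth_on U f" "smooth_on U g"
  shows "smooth_on U (\<lambda>p. f p + g p)"
  by (rule smooth_onI, rule Ck_on_add[OF assms(1) smooth_onD[OF assms(2)] smooth_onD[OF assms(3)]])

lemma smooth_on_bounded_linear_comp:
  assumes "open U" "bounded_linear L" "smooth_on U f"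
  shows "smooth_on U (\<lambda>p. L (f p))"
  by (rule smooth_onI, rule Ck_on_bounded_linear_comp[OF assms(1,2) smooth_onD[OF assms(3)]])

lemma smooth_on_minus:
  assumes "open U" "smooth_on U f"
  shows "smooth_on U (\<lambda>p. - f p)"
  by (rule smooth_on_bounded_linear_comp[OF assms(1) bounded_linear_minus[OF bounded_linear_ident] assms(2)])

lemma smooth_on_diff:
  assumes "open U" "smooth_on U f" "smooth_on U g"
  shows "smooth_on U (\<lambda>p. f p - g p)"
  using smooth_on_add[OF assms(1,2) smooth_on_minus[OF assms(1,3)]] by simp

lemma smooth_on_comp_bounded_linear:
  assumes "open U" "open V" "bounded_linear L" "L ` U \<subseteq> V" "smooth_on V f"
  shows "smooth_on U (\<lambda>p. f (L p))"
  by (rule smooth_onI, rule Ck_on_comp_bounded_linear[OF assms(1-4) smooth_onD[OF assms(5)]])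

lemma (in bounded_bilinear) smooth_on_bilinear:
  assumes "open U" "smooth_on U f" "smooth_on U g"
  shows "smooth_on U (\<lambda>p. prod (f p) (g p))"
  by (rule smooth_onI, rule Ck_on_bilinear[OF assms(1) smooth_onD[OF assms(2)] smooth_onD[OF assms(3)]])

lemma smooth_on_sum:
  assumes "open U" "\<And>i. i \<in> I \<Longrightarrow> smooth_on U (f i)"
  shows "smooth_on U (\<lambda>p. \<Sum>i\<in>I. f i p)"
proof (cases "finite I")
  case True
  then show ?thesis using assms(2)
  proof (induction I)
    case empty
    show ?case unfolding sum.empty by (rule smooth_on_const[OF assms(1)])
  next
    case (insert i I)
    have "smooth_on U (\<lambda>p. f i p + (\<Sum>i\<in>I. f i p))"
      by (rule smooth_on_add[OF assms(1) insert.prems insert.IH[OF insert.prems]]) simp_all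
    then show ?case unfolding sum.insert[OF insert.hyps(1,2)] .
  qed
next
  case False
  then show ?thesis using smooth_on_const[OF assms(1)] by simp
qed

lemma smooth_on_frechet_derivative:
  assumes "smooth_on U f"
  shows "smooth_on U (\<lambda>p. frechet_derivative f (at p) v)"
  by (rule smooth_onI, rule Ck_on_Suc_frechet_derivative[OF smooth_onD[OF assms]])

lemma smooth_on_has_derivative:
  assumes "smooth_on U f" "p \<in> U"
  shows "(f has_derivative frechet_derivative f (at p)) (at p)"
  by (rule Ck_on_Suc_has_derivative[OF smooth_onD[OF assms(1)] assms(2)])

lemma smooth_on_continuous: "smooth_on U f \<Longrightarrow> continuous_on U f"
  using smooth_onD[of U f 0] by simp

lemma frechet_derivative_expand:
  fixes f :: "'a::euclidean_space \<Rightarrow> 'b::real_normed_vector"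
  assumes "(f has_derivative f') (at p)"
  shows "frechet_derivative f (at p) v = (\<Sum>b\<in>Basis. (v \<bullet> b) *\<^sub>R frechet_derivative f (at p) b)"
proof -
  have "f' v = f' (\<Sum>b\<in>Basis. (v \<bullet> b) *\<^sub>R b)" by (simp add: euclidean_representation)
  also have "\<dots> = (\<Sum>b\<in>Basis. (v \<bullet> b) *\<^sub>R f' b)"
    using has_derivative_linear[OF assms] by (simp add: linear_sum linear_scale)
  finally show ?thesis using frechet_derivative_at[OF assms] by simp
qed

text \<open>
  The definition of smoothness only controls derivatives in constant directions. A variable
  direction \<open>X p\<close> is reduced to these by expanding it in the standard basis.
\<close>

lemma smooth_on_directional_derivative:
  assumes "open U" "smooth_on U f" "smooth_on U X"
  shows "smooth_on U (\<lambda>p. frechet_derivative f (at p) (X p))"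
proof (rule smooth_on_cong[OF assms(1)])
  show "(\<Sum>b\<in>Basis. (X p \<bullet> b) *\<^sub>R frechet_derivative f (at p) b) = frechet_derivative f (at p) (X p)"
    if "p \<in> U" for p
    by (rule frechet_derivative_expand[OF smooth_on_has_derivative[OF assms(2) that], symmetric])
  show "smooth_on U (\<lambda>p. \<Sum>b\<in>Basis. (X p \<bullet> b) *\<^sub>R frechet_derivative f (at p) b)"
    by (intro smooth_on_sum assms(1) bounded_bilinear.smooth_on_bilinear[OF bounded_bilinear_scaleR]
        smooth_on_bounded_linear_comp[OF _ bounded_linear_inner_left] smooth_on_frechet_derivative assms)
qed

text \<open>
  The product rule for the pairing of \<open>df\<close> with \<open>X\<close>: differentiating first \<open>df\<close> and then \<open>X\<close>.
\<close>

lemma has_derivative_directional: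
  fixes f :: "'a::euclidean_space \<Rightarrow> 'b::real_normed_vector"
  assumes "open U" "smooth_on U f" "smooth_on U X" "p \<in> U"
  shows "((\<lambda>q. frechet_derivative f (at q) (X q)) has_derivative
     (\<lambda>v. frechet_derivative (\<lambda>q. frechet_derivative f (at q) (X p)) (at p) v +
       frechet_derivative f (at p) (frechet_derivative X (at p) v))) (at p)"
proof -
  note df = smooth_on_has_derivative[OF assms(2)]
  note dX = smooth_on_has_derivative[OF assms(3,4)]
  note ddf = smooth_on_has_derivative[OF smooth_on_frechet_derivative[OF assms(2)] assms(4)]
  let ?e = "\<lambda>b. frechet_derivative f (at p) b"
  let ?dd = "\<lambda>b. frechet_derivative (\<lambda>q. frechet_derivative f (at q) b) (at p)"
  have *: "((\<lambda>q. \<Sum>b\<in>Basis. (X q \<bullet> b) *\<^sub>R frechet_derivative f (at q) b) has_derivative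
     (\<lambda>v. \<Sum>b\<in>Basis. (X p \<bullet> b) *\<^sub>R ?dd b v + (frechet_derivative X (at p) v \<bullet> b) *\<^sub>R ?e b)) (at p)"
    by (intro has_derivative_sum has_derivative_scaleR ddf has_derivative_inner_left[OF dX])
  have "((\<lambda>q. \<Sum>b\<in>Basis. (X p \<bullet> b) *\<^sub>R frechet_derivative f (at q) b) has_derivative
     (\<lambda>v. \<Sum>b\<in>Basis. (X p \<bullet> b) *\<^sub>R ?dd b v)) (at p)"
    by (intro has_derivative_sum has_derivative_scaleR_right ddf)
  then have "((\<lambda>q. frechet_derivative f (at q) (X p)) has_derivative
     (\<lambda>v. \<Sum>b\<in>Basis. (X p \<bullet> b) *\<^sub>R ?dd b v)) (at p)"
    by (rule has_derivative_transform_within_open[OF _ assms(1,4)])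
      (rule frechet_derivative_expand[OF df, symmetric])
  note dd = fun_cong[OF frechet_derivative_at[OF this], symmetric]
  have eq: "(\<Sum>b\<in>Basis. (X p \<bullet> b) *\<^sub>R ?dd b v + (frechet_derivative X (at p) v \<bullet> b) *\<^sub>R ?e b)
      = ?dd (X p) v + ?e (frechet_derivative X (at p) v)" for v
    unfolding sum.distrib dd
    by (rule arg_cong2[where f = "(+)", OF refl frechet_derivative_expand[OF df[OF assms(4)], symmetric]])
  show ?thesis
    by (rule has_derivative_transform_within_open[OF *[unfolded eq] assms(1,4)])
      (rule frechet_derivative_expand[OF df, symmetric])
qed

text \<open>
  The second difference is the increment over the \<open>v\<close>-side of the function that takes the
  difference across the \<open>w\<close>-side. Two applications of the mean value theorem, first along \<open>v\<close> and
  then along \<open>w\<close>, turn it into a value of the mixed derivative.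
\<close>

lemma second_difference_mean_value:
  fixes f :: "'a::real_normed_vector \<Rightarrow> real"
  assumes t: "t > 0"
    and df: "\<And>a b. \<lbrakk>0 \<le> a; a \<le> t; 0 \<le> b; b \<le> t\<rbrakk> \<Longrightarrow> f differentiable (at (p + a *\<^sub>R v + b *\<^sub>R w))"
    and ddf: "\<And>a b. \<lbrakk>0 \<le> a; a \<le> t; 0 \<le> b; b \<le> t\<rbrakk> \<Longrightarrow>
      (\<lambda>q. frechet_derivative f (at q) v) differentiable (at (p + a *\<^sub>R v + b *\<^sub>R w))"
  obtains a b where "0 < a" "a < t" "0 < b" "b < t"
    "f (p + t *\<^sub>R v + t *\<^sub>R w) - f (p + t *\<^sub>R v) - f (p + t *\<^sub>R w) + f p =
      t * t * frechet_derivative (\<lambda>q. frechet_derivative f (at q) v) (at (p + a *\<^sub>R v + b *\<^sub>R w)) w"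
proof -
  let ?f' = "\<lambda>q. frechet_derivative f (at q) v"
  have d1: "((\<lambda>a. f (p + a *\<^sub>R v + b *\<^sub>R w)) has_real_derivative ?f' (p + a *\<^sub>R v + b *\<^sub>R w)) (at a)"
    if "0 \<le> a" "a \<le> t" "0 \<le> b" "b \<le> t" for a b
  proof -
    have "((\<lambda>a. p + a *\<^sub>R v + b *\<^sub>R w) has_derivative (\<lambda>h. h *\<^sub>R v)) (at a)"
      by (auto intro!: derivative_eq_intros)
    from diff_chain_at[OF this frechet_derivative_works[THEN iffD1, OF df[OF that]]]
    have "((\<lambda>a. f (p + a *\<^sub>R v + b *\<^sub>R w)) has_derivative
        (\<lambda>h. frechet_derivative f (at (p + a *\<^sub>R v + b *\<^sub>R w)) (h *\<^sub>R v))) (at a)"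
      by (simp add: o_def)
    also have "(\<lambda>h. frechet_derivative f (at (p + a *\<^sub>R v + b *\<^sub>R w)) (h *\<^sub>R v)) =
        (*) (frechet_derivative f (at (p + a *\<^sub>R v + b *\<^sub>R w)) v)"
      by (rule ext) (simp add: linear_scale[OF linear_frechet_derivative[OF df[OF that]]] mult.commute)
    finally show ?thesis unfolding has_field_derivative_def .
  qed
  have d2: "((\<lambda>b. ?f' (p + a *\<^sub>R v + b *\<^sub>R w)) has_real_derivative
      frechet_derivative ?f' (at (p + a *\<^sub>R v + b *\<^sub>R w)) w) (at b)"
    if "0 \<le> a" "a \<le> t" "0 \<le> b" "b \<le> t" for a b
  proof -
    have "((\<lambda>b. p + a *\<^sub>R v + b *\<^sub>R w) has_derivative (\<lambda>h. h *\<^sub>R w)) (at b)"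
      by (auto intro!: derivative_eq_intros)
    from diff_chain_at[OF this frechet_derivative_works[THEN iffD1, OF ddf[OF that]]]
    have "((\<lambda>b. ?f' (p + a *\<^sub>R v + b *\<^sub>R w)) has_derivative
        (\<lambda>h. frechet_derivative ?f' (at (p + a *\<^sub>R v + b *\<^sub>R w)) (h *\<^sub>R w))) (at b)"
      by (simp add: o_def)
    also have "(\<lambda>h. frechet_derivative ?f' (at (p + a *\<^sub>R v + b *\<^sub>R w)) (h *\<^sub>R w)) =
        (*) (frechet_derivative ?f' (at (p + a *\<^sub>R v + b *\<^sub>R w)) w)"
      by (rule ext) (simp add: linear_scale[OF linear_frechet_derivative[OF ddf[OF that]]] mult.commute)
    finally show ?thesis unfolding has_field_derivative_def .
  qed
  have "\<exists>a. 0 < a \<and> a < t \<and> (f (p + t *\<^sub>R v + t *\<^sub>R w) - f (p + t *\<^sub>R v + 0 *\<^sub>R w)) -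
      (f (p + 0 *\<^sub>R v + t *\<^sub>R w) - f (p + 0 *\<^sub>R v + 0 *\<^sub>R w)) =
      (t - 0) * (?f' (p + a *\<^sub>R v + t *\<^sub>R w) - ?f' (p + a *\<^sub>R v + 0 *\<^sub>R w))"
    by (rule MVT2[OF t]) (use t in \<open>intro DERIV_diff d1; simp\<close>)
  then obtain a where a: "0 < a" "a < t" and *: "f (p + t *\<^sub>R v + t *\<^sub>R w) - f (p + t *\<^sub>R v) - f (p + t *\<^sub>R w) + f p =
      t * (?f' (p + a *\<^sub>R v + t *\<^sub>R w) - ?f' (p + a *\<^sub>R v + 0 *\<^sub>R w))"
    by auto
  have "\<exists>b. 0 < b \<and> b < t \<and> ?f' (p + a *\<^sub>R v + t *\<^sub>R w) - ?f' (p + a *\<^sub>R v + 0 *\<^sub>R w) =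
      (t - 0) * frechet_derivative ?f' (at (p + a *\<^sub>R v + b *\<^sub>R w)) w"
    by (rule MVT2[OF t]) (use a in \<open>intro d2; simp\<close>)
  then obtain b where "0 < b" "b < t" "?f' (p + a *\<^sub>R v + t *\<^sub>R w) - ?f' (p + a *\<^sub>R v + 0 *\<^sub>R w) =
      t * frechet_derivative ?f' (at (p + a *\<^sub>R v + b *\<^sub>R w)) w"
    by auto
  with a * show ?thesis by (intro that[of a b]) auto
qed

text \<open>
  The second difference over a parallelogram is symmetric in its two sides. By the mean value
  property it is \<open>t\<^sup>2\<close> times a value of either mixed derivative near \<open>p\<close>, so by continuity the two
  mixed derivatives agree at \<open>p\<close>.
\<close>

lemma second_derivative_symmetric_real:
  fixes f :: "'a::euclidean_space \<Rightarrow> real"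
  assumes U: "open U" "p \<in> U" and f: "smooth_on U f"
  shows "frechet_derivative (\<lambda>q. frechet_derivative f (at q) v) (at p) w =
    frechet_derivative (\<lambda>q. frechet_derivative f (at q) w) (at p) v"
proof (rule ccontr)
  let ?D = "\<lambda>v w q. frechet_derivative (\<lambda>q. frechet_derivative f (at q) v) (at q) w"
  assume ne: "\<not> ?thesis"
  define e where "e = dist (?D v w p) (?D w v p) / 2"
  have "e > 0" using ne by (simp add: e_def)
  have cont: "isCont (?D v w) p" for v w
    using smooth_on_continuous[OF smooth_on_frechet_derivative[OF smooth_on_frechet_derivative[OF f]]] U
    by (simp add: continuous_on_eq_continuous_at)
  have near: "\<forall>\<^sub>F q in nhds p. dist (?D v w q) (?D v w p) < e" for v w
    by (rule tendstoD[OF iffD1[OF tendsto_at_iff_tendsto_nhds[of "?D v w" p]] \<open>e > 0\<close>])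
      (rule cont[unfolded isCont_def])
  have "\<forall>\<^sub>F q in nhds p. q \<in> U \<and> dist (?D v w q) (?D v w p) < e \<and> dist (?D w v q) (?D w v p) < e"
    using near[of v w] near[of w v] eventually_nhds_in_open[OF U] by eventually_elim auto
  then obtain d where "d > 0" and d: "\<And>q. dist q p < d \<Longrightarrow>
      q \<in> U \<and> dist (?D v w q) (?D v w p) < e \<and> dist (?D w v q) (?D w v p) < e"
    unfolding eventually_nhds_metric by blast
  \<comment> \<open>the summand \<open>1\<close> keeps \<open>N\<close> positive; with this \<open>t\<close> the parallelogram stays within distance \<open>d / 2\<close> of \<open>p\<close>\<close>
  define N where "N = norm v + norm w + 1"
  define t where "t = d / (2 * N)"
  have pos: "N > 0" unfolding N_def by (smt (verit) norm_ge_zero)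
  then have t: "t > 0" using \<open>d > 0\<close> by (simp add: t_def)
  have close: "dist (p + a *\<^sub>R v + b *\<^sub>R w) p < d"
    if "0 \<le> a" "a \<le> t" "0 \<le> b" "b \<le> t" for a b
  proof -
    have "dist (p + a *\<^sub>R v + b *\<^sub>R w) p \<le> a * norm v + b * norm w"
      using norm_triangle_ineq[of "a *\<^sub>R v" "b *\<^sub>R w"] that by (simp add: dist_norm)
    also have "\<dots> \<le> t * norm v + t * norm w" using that by (intro add_mono mult_right_mono) auto
    also have "\<dots> \<le> t * N" using t by (simp add: N_def algebra_simps)
    also have "\<dots> = d / 2" using pos by (simp add: t_def)
    also have "\<dots> < d" using \<open>d > 0\<close> by simp
    finally show ?thesis .
  qed
  have diff: "f differentiable (at q)" "(\<lambda>q. frechet_derivative f (at q) x) differentiable (at q)"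
    if "q \<in> U" for q x
    using smooth_on_has_derivative[OF f that] smooth_on_has_derivative[OF smooth_on_frechet_derivative[OF f] that]
    by (auto simp: differentiable_def)
  have mean: "\<exists>a b. 0 < a \<and> a < t \<and> 0 < b \<and> b < t \<and>
      f (p + t *\<^sub>R x + t *\<^sub>R y) - f (p + t *\<^sub>R x) - f (p + t *\<^sub>R y) + f p =
      t * t * ?D x y (p + a *\<^sub>R x + b *\<^sub>R y)"
    if "\<And>a b. \<lbrakk>0 \<le> a; a \<le> t; 0 \<le> b; b \<le> t\<rbrakk> \<Longrightarrow> p + a *\<^sub>R x + b *\<^sub>R y \<in> U" for x y
    by (rule second_difference_mean_value[OF t, of f p x y]; (rule diff, rule that; assumption)?) blast
  have in_U: "p + a *\<^sub>R v + b *\<^sub>R w \<in> U" if "0 \<le> a" "a \<le> t" "0 \<le> b" "b \<le> t" for a b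
    using d[OF close[OF that]] by blast
  have swap: "p + a *\<^sub>R w + b *\<^sub>R v = p + b *\<^sub>R v + a *\<^sub>R w" for a b by simp
  obtain a b where ab: "0 < a" "a < t" "0 < b" "b < t"
    "f (p + t *\<^sub>R v + t *\<^sub>R w) - f (p + t *\<^sub>R v) - f (p + t *\<^sub>R w) + f p = t * t * ?D v w (p + a *\<^sub>R v + b *\<^sub>R w)"
    using mean[OF in_U] by blast
  have in_U': "p + a *\<^sub>R w + b *\<^sub>R v \<in> U" if "0 \<le> a" "a \<le> t" "0 \<le> b" "b \<le> t" for a b
    unfolding swap using that by (intro in_U)
  obtain a' b' where ab': "0 < a'" "a' < t" "0 < b'" "b' < t"
    "f (p + t *\<^sub>R w + t *\<^sub>R v) - f (p + t *\<^sub>R w) - f (p + t *\<^sub>R v) + f p = t * t * ?D w v (p + a' *\<^sub>R w + b' *\<^sub>R v)"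
    using mean[OF in_U'] by blast
  have "t * t * ?D v w (p + a *\<^sub>R v + b *\<^sub>R w) = t * t * ?D w v (p + a' *\<^sub>R w + b' *\<^sub>R v)"
    using ab(5) ab'(5) by (simp add: algebra_simps)
  then have "?D v w (p + a *\<^sub>R v + b *\<^sub>R w) = ?D w v (p + a' *\<^sub>R w + b' *\<^sub>R v)" using t by simp
  moreover have "dist (?D v w (p + a *\<^sub>R v + b *\<^sub>R w)) (?D v w p) < e"
    using d[OF close] ab by simp
  moreover have "dist (?D w v (p + a' *\<^sub>R w + b' *\<^sub>R v)) (?D w v p) < e"
    using d[OF close[of b' a']] ab' by (simp add: algebra_simps)
  ultimately show False
    using dist_triangle3[of "?D v w p" "?D w v p" "?D v w (p + a *\<^sub>R v + b *\<^sub>R w)"] by (simp add: e_def)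
qed

lemma second_derivative_symmetric:
  fixes f :: "'a::euclidean_space \<Rightarrow> 'b::euclidean_space"
  assumes U: "open U" "p \<in> U" and f: "smooth_on U f"
  shows "frechet_derivative (\<lambda>q. frechet_derivative f (at q) v) (at p) w =
    frechet_derivative (\<lambda>q. frechet_derivative f (at q) w) (at p) v"
proof (rule euclidean_eqI)
  fix b :: 'b
  have fb: "smooth_on U (\<lambda>q. f q \<bullet> b)"
    by (rule smooth_on_bounded_linear_comp[OF U(1) bounded_linear_inner_left f])
  have inner: "frechet_derivative (\<lambda>q. g q \<bullet> b) (at q) x = frechet_derivative g (at q) x \<bullet> b"
    if "q \<in> U" "smooth_on U g" for g :: "'a \<Rightarrow> 'b" and q x
    using frechet_derivative_at[OF has_derivative_inner_left[OF smooth_on_has_derivative[OF that(2,1)]]] by metis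
  have second: "frechet_derivative (\<lambda>q. frechet_derivative (\<lambda>q. f q \<bullet> b) (at q) x) (at p) y =
      frechet_derivative (\<lambda>q. frechet_derivative f (at q) x) (at p) y \<bullet> b" for x y
  proof -
    have "(\<lambda>q. frechet_derivative (\<lambda>q. f q \<bullet> b) (at q) x) differentiable (at p)"
      using smooth_on_has_derivative[OF smooth_on_frechet_derivative[OF fb] U(2)] by (auto simp: differentiable_def)
    then have "frechet_derivative (\<lambda>q. frechet_derivative (\<lambda>q. f q \<bullet> b) (at q) x) (at p) =
        frechet_derivative (\<lambda>q. frechet_derivative f (at q) x \<bullet> b) (at p)"
      by (rule frechet_derivative_transform_within_open[OF _ U]) (rule inner[OF _ f])
    then show ?thesis using inner[OF U(2) smooth_on_frechet_derivative[OF f]] by simp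
  qed
  show "frechet_derivative (\<lambda>q. frechet_derivative f (at q) v) (at p) w \<bullet> b =
    frechet_derivative (\<lambda>q. frechet_derivative f (at q) w) (at p) v \<bullet> b"
    using second_derivative_symmetric_real[OF U fb, of v w] by (simp add: second)
qed

section \<open>Connections that coincide with the standard one\<close>

text \<open>
  A connection is an operator on total functions, but only its values on fields that are smooth on
  \<open>U\<close>, at points of \<open>U\<close>, are meaningful. Equality of connections has to be relativised accordingly.
\<close>

definition agrees_with_std :: "'a::euclidean_space set \<Rightarrow> 'a connection \<Rightarrow> bool" where
  "agrees_with_std U D \<longleftrightarrow>
     (\<forall>X Y. smooth_on U X \<longrightarrow> smooth_on U Y \<longrightarrow> (\<forall>p\<in>U. D X Y p = std_connection X Y p))"

lemma agrees_with_stdD: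
  "agrees_with_std U D \<Longrightarrow> smooth_on U X \<Longrightarrow> smooth_on U Y \<Longrightarrow> p \<in> U \<Longrightarrow>
    D X Y p = frechet_derivative Y (at p) (X p)"
  unfolding agrees_with_std_def std_connection_def by blast

lemma agrees_with_std_std: "agrees_with_std U std_connection"
  unfolding agrees_with_std_def by blast

lemma frechet_derivative_eqI: "(f has_derivative f') (at p) \<Longrightarrow> frechet_derivative f (at p) = f'"
  by (rule frechet_derivative_at[symmetric])

lemma linear_connection_std:
  fixes U :: "'a::euclidean_space set"
  assumes "open U"
  shows "linear_connection U std_connection"
  unfolding linear_connection_def std_connection_def
proof (intro conjI allI impI ballI)
  fix X Y :: "'a \<Rightarrow> 'a"
  assume "smooth_on U X" "smooth_on U Y"
  then show "smooth_on U (\<lambda>p. frechet_derivative Y (at p) (X p))"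
    by (intro smooth_on_directional_derivative[OF assms])
next
  fix X X' Y :: "'a \<Rightarrow> 'a" and p
  assume "smooth_on U Y" "p \<in> U"
  note lin = has_derivative_linear[OF smooth_on_has_derivative[OF this]]
  show "frechet_derivative Y (at p) (X p + X' p) = frechet_derivative Y (at p) (X p) + frechet_derivative Y (at p) (X' p)"
    by (rule linear_add[OF lin])
next
  fix X Y Y' :: "'a \<Rightarrow> 'a" and p
  assume "smooth_on U Y" "smooth_on U Y'" "p \<in> U"
  note der = smooth_on_has_derivative[OF this(1,3)] smooth_on_has_derivative[OF this(2,3)]
  show "frechet_derivative (\<lambda>q. Y q + Y' q) (at p) (X p) = frechet_derivative Y (at p) (X p) + frechet_derivative Y' (at p) (X p)"
    unfolding frechet_derivative_eqI[OF has_derivative_add[OF der]] ..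
next
  fix f :: "'a \<Rightarrow> real" and X Y :: "'a \<Rightarrow> 'a" and p
  assume "smooth_on U Y" "p \<in> U"
  note lin = has_derivative_linear[OF smooth_on_has_derivative[OF this]]
  show "frechet_derivative Y (at p) (f p *\<^sub>R X p) = f p *\<^sub>R frechet_derivative Y (at p) (X p)"
    by (rule linear_scale[OF lin])
next
  fix f :: "'a \<Rightarrow> real" and X Y :: "'a \<Rightarrow> 'a" and p
  assume "smooth_on U f" "smooth_on U Y" "p \<in> U"
  note der = smooth_on_has_derivative[OF this(1,3)] smooth_on_has_derivative[OF this(2,3)]
  show "frechet_derivative (\<lambda>q. f q *\<^sub>R Y q) (at p) (X p) =
      frechet_derivative f (at p) (X p) *\<^sub>R Y p + f p *\<^sub>R frechet_derivative Y (at p) (X p)"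
    unfolding frechet_derivative_eqI[OF has_derivative_scaleR[OF der]] by (rule add.commute)
qed

lemma
  fixes U :: "'a::euclidean_space set" and f :: "'a \<Rightarrow> real" and X X' Y Y' :: "'a \<Rightarrow> 'a"
  assumes "linear_connection U D"
  shows linear_connection_smooth:
      "smooth_on U X \<Longrightarrow> smooth_on U Y \<Longrightarrow> smooth_on U (D X Y)"
    and linear_connection_add_left:
      "smooth_on U X \<Longrightarrow> smooth_on U X' \<Longrightarrow> smooth_on U Y \<Longrightarrow> p \<in> U \<Longrightarrow>
        D (\<lambda>q. X q + X' q) Y p = D X Y p + D X' Y p"
    and linear_connection_add_right:
      "smooth_on U X \<Longrightarrow> smooth_on U Y \<Longrightarrow> smooth_on U Y' \<Longrightarrow> p \<in> U \<Longrightarrow>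
        D X (\<lambda>q. Y q + Y' q) p = D X Y p + D X Y' p"
    and linear_connection_scale_left:
      "smooth_on U f \<Longrightarrow> smooth_on U X \<Longrightarrow> smooth_on U Y \<Longrightarrow> p \<in> U \<Longrightarrow>
        D (\<lambda>q. f q *\<^sub>R X q) Y p = f p *\<^sub>R D X Y p"
    and linear_connection_scale_right:
      "smooth_on U f \<Longrightarrow> smooth_on U X \<Longrightarrow> smooth_on U Y \<Longrightarrow> p \<in> U \<Longrightarrow>
        D X (\<lambda>q. f q *\<^sub>R Y q) p = frechet_derivative f (at p) (X p) *\<^sub>R Y p + f p *\<^sub>R D X Y p"
proof -
  note D = assms[unfolded linear_connection_def]
  note D2 = conjunct2[OF D] note D3 = conjunct2[OF D2] note D4 = conjunct2[OF D3]
  show "smooth_on U X \<Longrightarrow> smooth_on U Y \<Longrightarrow> smooth_on U (D X Y)"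
    by (rule conjunct1[OF D, rule_format])
  show "smooth_on U X \<Longrightarrow> smooth_on U X' \<Longrightarrow> smooth_on U Y \<Longrightarrow> p \<in> U \<Longrightarrow>
      D (\<lambda>q. X q + X' q) Y p = D X Y p + D X' Y p"
    by (rule conjunct1[OF D2, rule_format])
  show "smooth_on U X \<Longrightarrow> smooth_on U Y \<Longrightarrow> smooth_on U Y' \<Longrightarrow> p \<in> U \<Longrightarrow>
      D X (\<lambda>q. Y q + Y' q) p = D X Y p + D X Y' p"
    by (rule conjunct1[OF D3, rule_format])
  show "smooth_on U f \<Longrightarrow> smooth_on U X \<Longrightarrow> smooth_on U Y \<Longrightarrow> p \<in> U \<Longrightarrow>
      D (\<lambda>q. f q *\<^sub>R X q) Y p = f p *\<^sub>R D X Y p"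
    by (rule conjunct1[OF D4, rule_format])
  show "smooth_on U f \<Longrightarrow> smooth_on U X \<Longrightarrow> smooth_on U Y \<Longrightarrow> p \<in> U \<Longrightarrow>
      D X (\<lambda>q. f q *\<^sub>R Y q) p = frechet_derivative f (at p) (X p) *\<^sub>R Y p + f p *\<^sub>R D X Y p"
    by (rule conjunct2[OF D4, rule_format])
qed

text \<open>
  The curvature applied to \<open>Z\<close> is the antisymmetrised second derivative of \<open>Z\<close>, since the terms that
  differentiate \<open>X\<close> and \<open>Y\<close> add up to the derivative of \<open>Z\<close> along the bracket.
\<close>

lemma flat_affine_structure_if_agrees_with_std:
  fixes U :: "'a::euclidean_space set"
  assumes U: "open U" and D: "linear_connection U D" "agrees_with_std U D"
  shows "flat_affine_structure U D"
  unfolding flat_affine_structure_def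
proof (intro conjI D(1))
  note D_eq = agrees_with_stdD[OF D(2)]
  have smooth_D: "smooth_on U (D X Y)" if "smooth_on U X" "smooth_on U Y" for X Y
    by (rule linear_connection_smooth[OF D(1) that])
  show "torsion_free U D"
    unfolding torsion_free_def vf_bracket_def
  proof (intro allI impI ballI)
    fix X Y :: "'a \<Rightarrow> 'a" and p
    assume s: "smooth_on U X" "smooth_on U Y" and p: "p \<in> U"
    show "D X Y p - D Y X p = frechet_derivative Y (at p) (X p) - frechet_derivative X (at p) (Y p)"
      unfolding D_eq[OF s p] D_eq[OF s(2,1) p] ..
  qed
  show "flat U D"
    unfolding flat_def
  proof (intro allI impI ballI)
    fix X Y Z :: "'a \<Rightarrow> 'a" and p
    assume s: "smooth_on U X" "smooth_on U Y" "smooth_on U Z" and p: "p \<in> U"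
    let ?d2 = "\<lambda>v w. frechet_derivative (\<lambda>q. frechet_derivative Z (at q) v) (at p) w"
    have second: "D V (D W Z) p = ?d2 (W p) (V p) + frechet_derivative Z (at p) (frechet_derivative W (at p) (V p))"
      if VW: "smooth_on U V" "smooth_on U W" for V W :: "'a \<Rightarrow> 'a"
    proof -
      have "(D W Z has_derivative (\<lambda>v. ?d2 (W p) v + frechet_derivative Z (at p) (frechet_derivative W (at p) v))) (at p)"
        by (rule has_derivative_transform_within_open[OF has_derivative_directional[OF U s(3) VW(2) p] U p])
          (rule D_eq[OF VW(2) s(3), symmetric])
      then show ?thesis
        unfolding D_eq[OF VW(1) smooth_D[OF VW(2) s(3)] p] by (simp only: frechet_derivative_eqI)
    qed
    have bracket: "smooth_on U (vf_bracket X Y)"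
      unfolding vf_bracket_def[abs_def]
      by (intro smooth_on_diff smooth_on_directional_derivative U s)
    have "D X (D Y Z) p - D Y (D X Z) p = frechet_derivative Z (at p) (frechet_derivative Y (at p) (X p))
        - frechet_derivative Z (at p) (frechet_derivative X (at p) (Y p))"
      unfolding second[OF s(1,2)] second[OF s(2,1)] second_derivative_symmetric[OF U p s(3), of "Y p" "X p"] by simp
    also have "\<dots> = frechet_derivative Z (at p) (vf_bracket X Y p)"
      unfolding vf_bracket_def
      by (rule linear_diff[OF has_derivative_linear[OF smooth_on_has_derivative[OF s(3) p]], symmetric])
    also have "\<dots> = D (vf_bracket X Y) Z p"
      by (rule D_eq[OF bracket s(3) p, symmetric])
    finally show "D X (D Y Z) p - D Y (D X Z) p - D (vf_bracket X Y) Z p = 0"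
      by simp
  qed
qed

text \<open>
  For standard connections the obstruction to being affine is the second derivative of the map.
\<close>

lemma affine_map_if_agrees_with_std:
  fixes U :: "'a::euclidean_space set" and V :: "'b::euclidean_space set"
  assumes U: "open U" and V: "open V"
    and D: "agrees_with_std U D" and D': "agrees_with_std V D'"
    and L: "bounded_linear L" and F: "F ` U \<subseteq> V" "\<And>p. F p = c + L p"
  shows "affine_map U D V D' F"
  unfolding affine_map_def
proof (intro conjI allI impI ballI F(1))
  have F_eq: "F = (\<lambda>p. c + L p)" by (rule ext) (rule F(2))
  show "smooth_on U F"
    unfolding F_eq by (intro smooth_on_add smooth_on_const smooth_on_bounded_linear U L)
  have dF: "frechet_derivative F (at q) = L" for q
    unfolding F_eq
    by (rule frechet_derivative_eqI) (auto intro!: derivative_eq_intros bounded_linear_imp_has_derivative L)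
  have chr: "christoffel D' (F p) v w = 0" if "p \<in> U" for p v w
  proof -
    have "F p \<in> V" using F(1) that by blast
    from agrees_with_stdD[OF D' smooth_on_const[OF V] smooth_on_const[OF V] this]
    show ?thesis unfolding christoffel_def by (simp add: frechet_derivative_eqI[OF has_derivative_const])
  qed
  fix X Y :: "'a \<Rightarrow> 'a" and p
  assume s: "smooth_on U X" "smooth_on U Y" and p: "p \<in> U"
  have "((\<lambda>q. L (Y q)) has_derivative (\<lambda>v. L (frechet_derivative Y (at p) v))) (at p)"
    by (rule bounded_linear.has_derivative[OF L smooth_on_has_derivative[OF s(2) p]])
  then show "frechet_derivative F (at p) (D X Y p) =
      pullback_connection D' F X (\<lambda>q. frechet_derivative F (at q) (Y q)) p"
    unfolding pullback_connection_def dF chr[OF p] agrees_with_stdD[OF D s p]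
    by (simp add: frechet_derivative_eqI)
qed

text \<open>
  An operator that is linear over smooth functions, evaluated at \<open>p\<close>, only sees the coefficients at
  \<open>p\<close>. The expansion of \<open>X\<close> is only assumed on \<open>U\<close>, so one also needs that \<open>\<Phi>\<close> ignores values
  outside \<open>U\<close>.
\<close>

lemma tensorial_eq_zero_if_zero_on_frame:
  fixes \<Phi> :: "('a::euclidean_space \<Rightarrow> 'a) \<Rightarrow> 'b::real_vector"
  assumes U: "open U" "p \<in> U"
    and add: "\<And>X X'. smooth_on U X \<Longrightarrow> smooth_on U X' \<Longrightarrow> \<Phi> (\<lambda>q. X q + X' q) = \<Phi> X + \<Phi> X'"
    and scale: "\<And>f X. smooth_on U f \<Longrightarrow> smooth_on U X \<Longrightarrow> \<Phi> (\<lambda>q. f q *\<^sub>R X q) = f p *\<^sub>R \<Phi> X"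
    and E: "\<And>i. i \<in> I \<Longrightarrow> smooth_on U (E i)" "\<And>i. i \<in> I \<Longrightarrow> \<Phi> (E i) = 0"
    and c: "\<And>i. i \<in> I \<Longrightarrow> smooth_on U (c i)"
    and X: "smooth_on U X" "\<And>q. q \<in> U \<Longrightarrow> X q = (\<Sum>i\<in>I. c i q *\<^sub>R E i q)"
  shows "\<Phi> X = 0"
proof -
  have zero_on: "\<Phi> Z = 0" if Z: "smooth_on U Z" "\<And>q. q \<in> U \<Longrightarrow> Z q = 0" for Z
  proof -
    \<comment> \<open>as \<open>U\<close> is open, the indicator of its complement is smooth on \<open>U\<close>; multiplication by it fixes \<open>Z\<close>\<close>
    define f :: "'a \<Rightarrow> real" where "f q = (if q \<in> U then 0 else 1)" for q
    have "smooth_on U f"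
      by (rule smooth_on_cong[OF U(1) _ smooth_on_const[OF U(1)]]) (simp add: f_def)
    from scale[OF this Z(1)] have "\<Phi> (\<lambda>q. f q *\<^sub>R Z q) = 0" using U(2) by (simp add: f_def)
    moreover have "(\<lambda>q. f q *\<^sub>R Z q) = Z" using Z(2) by (auto simp: f_def fun_eq_iff)
    ultimately show ?thesis by simp
  qed
  let ?S = "\<lambda>J q. \<Sum>i\<in>J. c i q *\<^sub>R E i q"
  have cE: "smooth_on U (\<lambda>q. c i q *\<^sub>R E i q)" if "i \<in> I" for i
    by (rule bounded_bilinear.smooth_on_bilinear[OF bounded_bilinear_scaleR U(1) c[OF that] E(1)[OF that]])
  have S: "smooth_on U (?S J)" if "J \<subseteq> I" for J
    by (rule smooth_on_sum[OF U(1) cE]) (use that in blast)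
  have zero_sum: "\<Phi> (?S J) = 0" if "finite J" "J \<subseteq> I" for J
    using that
  proof (induction J)
    case empty
    show ?case by (rule zero_on) (simp_all add: smooth_on_const[OF U(1)])
  next
    case (insert i J)
    then have i: "i \<in> I" and J: "J \<subseteq> I" by auto
    have "?S (insert i J) = (\<lambda>q. c i q *\<^sub>R E i q + ?S J q)"
      by (rule ext, rule sum.insert[OF insert.hyps(1,2)])
    then have "\<Phi> (?S (insert i J)) = \<Phi> (\<lambda>q. c i q *\<^sub>R E i q) + \<Phi> (?S J)"
      by (simp only: add[OF cE[OF i] S[OF J]])
    also have "\<dots> = 0"
      unfolding scale[OF c[OF i] E(1)[OF i]] E(2)[OF i] insert.IH[OF J] by simp
    finally show ?case .
  qed
  have "\<Phi> (?S I) = 0"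
  proof (cases "finite I")
    case True
    then show ?thesis by (rule zero_sum) simp
  next
    case False
    then show ?thesis by (intro zero_on S) simp_all
  qed
  moreover have "\<Phi> (\<lambda>q. X q - ?S I q) = 0"
    by (rule zero_on) (use X S[of I] in \<open>simp_all add: smooth_on_diff[OF U(1)]\<close>)
  moreover have "\<Phi> X = \<Phi> (\<lambda>q. ?S I q + (X q - ?S I q))" by simp
  moreover have "\<dots> = \<Phi> (?S I) + \<Phi> (\<lambda>q. X q - ?S I q)"
    by (rule add[OF S smooth_on_diff[OF U(1) X(1) S]]) simp_all
  ultimately show ?thesis by simp
qed

text \<open>
  The difference from the standard connection is tensorial in both arguments: in the second one the
  Leibniz terms cancel. It is killed first in the second argument, with a frame field in the
  first one, and then in the first argument.
\<close>

lemma agrees_with_std_if_agrees_on_frame: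
  fixes U :: "'a::euclidean_space set"
  assumes U: "open U" and D: "linear_connection U D"
    and E: "\<And>i. i \<in> I \<Longrightarrow> smooth_on U (E i)"
    and frame: "\<And>X. smooth_on U X \<Longrightarrow>
      \<exists>c. (\<forall>i\<in>I. smooth_on U (c i)) \<and> (\<forall>q\<in>U. X q = (\<Sum>i\<in>I. c i q *\<^sub>R E i q))"
    and eq: "\<And>i j p. \<lbrakk>i \<in> I; j \<in> I; p \<in> U\<rbrakk> \<Longrightarrow> D (E i) (E j) p = std_connection (E i) (E j) p"
  shows "agrees_with_std U D"
  unfolding agrees_with_std_def
proof (intro allI impI ballI)
  fix X Y :: "'a \<Rightarrow> 'a" and p
  assume s: "smooth_on U X" "smooth_on U Y" and p: "p \<in> U"
  note std = linear_connection_std[OF U]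
  have second: "D (E i) Y p - std_connection (E i) Y p = 0" if i: "i \<in> I" for i
  proof -
    obtain c where c: "\<forall>j\<in>I. smooth_on U (c j)" "\<forall>q\<in>U. Y q = (\<Sum>j\<in>I. c j q *\<^sub>R E j q)"
      using frame[OF s(2)] by blast
    note Ei = E[OF i]
    show ?thesis
    proof (rule tensorial_eq_zero_if_zero_on_frame[where \<Phi> = "\<lambda>Y. D (E i) Y p - std_connection (E i) Y p"
          and E = E and c = c and I = I, OF U p])
      show "D (E i) (\<lambda>q. Z q + Z' q) p - std_connection (E i) (\<lambda>q. Z q + Z' q) p =
          D (E i) Z p - std_connection (E i) Z p + (D (E i) Z' p - std_connection (E i) Z' p)"
        if z: "smooth_on U Z" "smooth_on U Z'" for Z Z'
        unfolding linear_connection_add_right[OF D Ei z p] linear_connection_add_right[OF std Ei z p] by simp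
      show "D (E i) (\<lambda>q. f q *\<^sub>R Z q) p - std_connection (E i) (\<lambda>q. f q *\<^sub>R Z q) p =
          f p *\<^sub>R (D (E i) Z p - std_connection (E i) Z p)"
        if z: "smooth_on U f" "smooth_on U Z" for f Z
        unfolding linear_connection_scale_right[OF D z(1) Ei z(2) p] linear_connection_scale_right[OF std z(1) Ei z(2) p] by (simp add: scaleR_diff_right)
      show "D (E i) (E j) p - std_connection (E i) (E j) p = 0" if "j \<in> I" for j
        using eq[OF i that p] by simp
    qed (use E c s in auto)
  qed
  obtain c where c: "\<forall>j\<in>I. smooth_on U (c j)" "\<forall>q\<in>U. X q = (\<Sum>j\<in>I. c j q *\<^sub>R E j q)"
    using frame[OF s(1)] by blast
  have "D X Y p - std_connection X Y p = 0"
  proof (rule tensorial_eq_zero_if_zero_on_frame[where \<Phi> = "\<lambda>X. D X Y p - std_connection X Y p"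
        and E = E and c = c and I = I, OF U p])
    note sY = s(2)
    show "D (\<lambda>q. Z q + Z' q) Y p - std_connection (\<lambda>q. Z q + Z' q) Y p =
        D Z Y p - std_connection Z Y p + (D Z' Y p - std_connection Z' Y p)"
      if z: "smooth_on U Z" "smooth_on U Z'" for Z Z'
      unfolding linear_connection_add_left[OF D z sY p] linear_connection_add_left[OF std z sY p] by simp
    show "D (\<lambda>q. f q *\<^sub>R Z q) Y p - std_connection (\<lambda>q. f q *\<^sub>R Z q) Y p = f p *\<^sub>R (D Z Y p - std_connection Z Y p)"
      if z: "smooth_on U f" "smooth_on U Z" for f Z
      unfolding linear_connection_scale_left[OF D z sY p] linear_connection_scale_left[OF std z sY p] by (simp add: scaleR_diff_right)
  qed (use E c s second in auto)
  then show "D X Y p = std_connection X Y p" by simp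
qed

section \<open>Smoothness of matrix inversion\<close>

lemma bilinear_matrix_mult:
  "bilinear ((**) :: real^'n^'m \<Rightarrow> real^'p^'n \<Rightarrow> real^'p^'m)"
  unfolding bilinear_def linear_iff
  by (simp add: matrix_matrix_mult_def vec_eq_iff sum.distrib distrib_left distrib_right sum_distrib_left mult_ac)

lemma bilinear_aff_product:
  "bilinear (aff_product :: ('n::finite) aff \<Rightarrow> 'n aff \<Rightarrow> 'n aff)"
  unfolding bilinear_def linear_iff
  by (simp add: aff_product_def split_beta matrix_matrix_mult_def matrix_vector_mult_def vec_eq_iff
      sum.distrib distrib_left distrib_right sum_distrib_left mult_ac)

lemmas bounded_bilinear_matrix_mult = bilinear_matrix_mult[unfolded bilinear_conv_bounded_bilinear]
lemmas bounded_bilinear_aff_product = bilinear_aff_product[unfolded bilinear_conv_bounded_bilinear]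

lemma aff_product_assoc: "aff_product (aff_product u v) w = aff_product u (aff_product v w)"
  by (simp add: aff_product_def split_beta matrix_mul_assoc matrix_vector_mul_assoc)

lemma matrix_inv:
  fixes A :: "'a::semiring_1 ^ 'n ^ 'm"
  assumes "invertible A"
  shows matrix_inv_right: "A ** matrix_inv A = mat 1"
    and matrix_inv_left: "matrix_inv A ** A = mat 1"
proof -
  have "A ** matrix_inv A = mat 1 \<and> matrix_inv A ** A = mat 1"
    using assms unfolding invertible_def matrix_inv_def by (rule someI_ex)
  then show "A ** matrix_inv A = mat 1" "matrix_inv A ** A = mat 1" by simp_all
qed

lemma invertible_matrix_inv: "invertible A \<Longrightarrow> invertible (matrix_inv A)"
  unfolding invertible_def[of "matrix_inv A"] using matrix_inv_left matrix_inv_right by blast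

lemma continuous_on_det:
  fixes f :: "'a::topological_space \<Rightarrow> real ^ 'n ^ 'n"
  assumes "continuous_on S f"
  shows "continuous_on S (\<lambda>x. det (f x))"
  unfolding det_def by (intro continuous_intros assms)

lemma open_invertible: "open {A :: real ^ 'n ^ 'n. invertible A}"
  unfolding invertible_det_nz
  by (intro open_Collect_neq continuous_on_det continuous_on_id continuous_on_const)

text \<open>
  Cramer's rule for the columns of the inverse; it exhibits the entries as quotients of determinants,
  which gives continuity.
\<close>

lemma matrix_inv_cramer:
  fixes A :: "real ^ 'n ^ 'n"
  assumes "invertible A"
  shows "matrix_inv A $ i $ j = det (\<chi> k l. if l = i then axis j 1 $ k else A $ k $ l) / det A"
proof -
  have "A *v (matrix_inv A *v axis j 1) = axis j 1"
    by (simp add: matrix_vector_mul_assoc matrix_inv_right[OF assms])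
  then have "matrix_inv A *v axis j 1 = (\<chi> i. det (\<chi> k l. if l = i then axis j 1 $ k else A $ k $ l) / det A)"
    by (rule iffD1[OF cramer[OF assms[unfolded invertible_det_nz]]])
  then have "(matrix_inv A *v axis j 1) $ i = det (\<chi> k l. if l = i then axis j 1 $ k else A $ k $ l) / det A"
    by (simp only: vec_lambda_beta)
  then show ?thesis
    by (simp add: matrix_vector_mult_basis column_def)
qed

lemma continuous_on_matrix_inv: "continuous_on {A :: real ^ 'n ^ 'n. invertible A} matrix_inv"
proof -
  have cont: "continuous_on S (\<lambda>A. if P then c else (A :: real ^ 'n ^ 'n) $ k $ l)" for S P c k l
    by (cases P) (auto intro!: continuous_intros)
  have "continuous_on {A :: real ^ 'n ^ 'n. invertible A}
      (\<lambda>A. \<chi> i j. det (\<chi> k l. if l = i then axis j 1 $ k else A $ k $ l) / det A)"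
    by (intro continuous_on_vec_lambda continuous_on_divide continuous_on_det cont continuous_on_id)
      (simp add: invertible_det_nz)
  then show ?thesis
    by (rule continuous_on_cong[THEN iffD1, OF refl, rotated]) (simp add: vec_eq_iff matrix_inv_cramer)
qed

text \<open>
  The resolvent identity \<open>B\<inverse> - A\<inverse> = - B\<inverse> (B - A) A\<inverse>\<close> shows that the remainder of the linear
  approximation is \<open>(A\<inverse> - B\<inverse>) (B - A) A\<inverse>\<close>. By continuity of inversion this is of smaller order
  than \<open>B - A\<close>.
\<close>

lemma has_derivative_matrix_inv:
  fixes A :: "real ^ 'n ^ 'n"
  assumes A: "invertible A"
  shows "(matrix_inv has_derivative (\<lambda>V. - (matrix_inv A ** V ** matrix_inv A))) (at A)"
  unfolding has_derivative_iff_norm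
proof
  interpret mm: bounded_bilinear "(**) :: real ^ 'n ^ 'n \<Rightarrow> real ^ 'n ^ 'n \<Rightarrow> real ^ 'n ^ 'n"
    by (rule bounded_bilinear_matrix_mult)
  let ?I = matrix_inv
  show "bounded_linear (\<lambda>V. - (?I A ** V ** ?I A))"
  proof (rule bounded_linear_minus)
    show "bounded_linear (\<lambda>V. ?I A ** V ** ?I A)"
      by (rule bounded_linear_compose[of "\<lambda>X. X ** ?I A" "\<lambda>V. ?I A ** V",
          OF mm.bounded_linear_left mm.bounded_linear_right])
  qed
  obtain K where K: "K > 0" "\<And>(X :: real ^ 'n ^ 'n) (Y :: real ^ 'n ^ 'n). norm (X ** Y) \<le> norm X * norm Y * K"
    using mm.pos_bounded by blast
  have bound: "norm (?I B - ?I A - - (?I A ** (B - A) ** ?I A)) / norm (B - A) \<le>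
      norm (?I A - ?I B) * K * norm (?I A) * K" if B: "invertible B" "B \<noteq> A" for B
  proof -
    have "(?I A - ?I B) ** (B - A) ** ?I A = ?I A ** (B - A) ** ?I A - ?I B ** (B - A) ** ?I A"
      by (simp only: mm.diff_left)
    also have "?I B ** (B - A) ** ?I A = (?I B ** B) ** ?I A - ?I B ** (A ** ?I A)"
      by (simp only: mm.diff_left mm.diff_right matrix_mul_assoc)
    also have "\<dots> = ?I A - ?I B"
      by (simp only: matrix_inv_left[OF B(1)] matrix_inv_right[OF A] matrix_mul_lid matrix_mul_rid)
    finally have "?I B - ?I A - - (?I A ** (B - A) ** ?I A) = (?I A - ?I B) ** (B - A) ** ?I A"
      by simp
    also have "norm \<dots> \<le> norm ((?I A - ?I B) ** (B - A)) * norm (?I A) * K"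
      by (rule K(2))
    also have "\<dots> \<le> (norm (?I A - ?I B) * norm (B - A) * K) * norm (?I A) * K"
      using K by (intro mult_right_mono K(2)) auto
    finally show ?thesis
      using B(2) by (simp add: divide_le_eq mult_ac)
  qed
  have "isCont ?I A"
    using continuous_on_matrix_inv A unfolding continuous_on_eq_continuous_at[OF open_invertible] by blast
  then have "((\<lambda>B. norm (?I A - ?I B) * K * norm (?I A) * K) \<longlongrightarrow> norm (?I A - ?I A) * K * norm (?I A) * K) (at A)"
    unfolding isCont_def by (intro tendsto_intros)
  then have lim: "((\<lambda>B. norm (?I A - ?I B) * K * norm (?I A) * K) \<longlongrightarrow> 0) (at A)"
    by simp
  have "\<forall>\<^sub>F B in at A. B \<in> {B. invertible B} \<and> B \<noteq> A"
    using open_invertible A by (intro eventually_conj eventually_at_in_open' eventually_neq_at_within) auto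
  then have ev: "\<forall>\<^sub>F B in at A. norm (norm (?I B - ?I A - - (?I A ** (B - A) ** ?I A)) / norm (B - A)) \<le>
      norm (?I A - ?I B) * K * norm (?I A) * K"
    by eventually_elim (use bound in simp)
  show "((\<lambda>B. norm (?I B - ?I A - - (?I A ** (B - A) ** ?I A)) / norm (B - A)) \<longlongrightarrow> 0) (at A)"
    by (rule Lim_null_comparison[OF ev lim])
qed

text \<open>
  The derivative of inversion is a polynomial in the inverse, so each order of smoothness yields the
  next one.
\<close>

lemma smooth_on_matrix_inv: "smooth_on {A :: real ^ 'n ^ 'n. invertible A} matrix_inv"
proof (rule smooth_onI)
  note mm = bounded_bilinear.Ck_on_bilinear[OF bounded_bilinear_matrix_mult open_invertible]
  show "Ck_on k {A :: real ^ 'n ^ 'n. invertible A} matrix_inv" for k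
  proof (induction k)
    case 0
    show ?case unfolding Ck_on.simps(1) by (rule continuous_on_matrix_inv)
  next
    case (Suc k)
    show ?case
    proof (rule Ck_on_Suc_intro[OF open_invertible])
      show "(matrix_inv has_derivative (\<lambda>V. - (matrix_inv A ** V ** matrix_inv A))) (at A)"
        if "A \<in> {A. invertible A}" for A :: "real ^ 'n ^ 'n"
        by (rule has_derivative_matrix_inv) (use that in simp)
      show "Ck_on k {A :: real ^ 'n ^ 'n. invertible A} (\<lambda>A. - (matrix_inv A ** V ** matrix_inv A))" for V
        by (rule Ck_on_bounded_linear_comp[OF open_invertible bounded_linear_minus[OF bounded_linear_ident]])
          (rule mm[OF mm[OF Suc Ck_on_const[OF open_invertible]] Suc])
    qed
  qed
qed

section \<open>Groups whose left invariant fields come from an associative product\<close>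

lemma (in bounded_bilinear) has_derivative_prod_left:
  "((\<lambda>g. prod g x) has_derivative (\<lambda>v. prod v x)) (at p)"
  by (rule bounded_linear_imp_has_derivative[OF bounded_linear_left])

text \<open>
  Together with associativity this is the defining equation of the connection determined by \<open>P\<close>.
\<close>

lemma std_connection_product_fields:
  fixes P :: "'a::euclidean_space \<Rightarrow> 'a \<Rightarrow> 'a"
  assumes "bounded_bilinear P"
  shows "std_connection (\<lambda>g. P g x) (\<lambda>g. P g y) p = P (P p x) y"
  unfolding std_connection_def
    frechet_derivative_eqI[OF bounded_bilinear.has_derivative_prod_left[OF assms]] ..

lemma lie_algebra_bracket_eq_commutator:
  fixes G :: "'a::euclidean_space monoid"
  assumes P: "bounded_bilinear P"
    and L: "\<And>x. left_inv_field G x = (\<lambda>g. P g x)"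
    and one: "\<And>x. P \<one>\<^bsub>G\<^esub> x = x"
  shows "lie_algebra_bracket G x y = P x y - P y x"
  unfolding lie_algebra_bracket_def vf_bracket_def L
    frechet_derivative_eqI[OF bounded_bilinear.has_derivative_prod_left[OF P]] one ..

lemma determined_by_product_std:
  fixes G :: "'a::euclidean_space monoid"
  assumes "open (carrier G)" and P: "bounded_bilinear P"
    and assoc: "\<And>x y z. P (P x y) z = P x (P y z)"
    and L: "\<And>x. left_inv_field G x = (\<lambda>g. P g x)"
  shows "determined_by_product G P std_connection"
  unfolding determined_by_product_def L std_connection_product_fields[OF P] assoc
  by (intro conjI linear_connection_std assms allI ballI refl)

text \<open>
  The map \<open>r\<close> supplies, for each \<open>q\<close>, an element whose left multiplication inverts that of \<open>q\<close>; the
  coefficients of a field \<open>X\<close> in the frame of left invariant fields are the coordinates of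
  \<open>P (r q) (X q)\<close>. It need not be the inverse of \<open>q\<close> in the group: for the affine group,
  \<open>r (a, A) = (0, A\<inverse>)\<close>.
\<close>

lemma agrees_with_std_if_determined_by_product:
  fixes G :: "'a::euclidean_space monoid"
  assumes U: "open (carrier G)" and P: "bounded_bilinear P"
    and assoc: "\<And>x y z. P (P x y) z = P x (P y z)"
    and L: "\<And>x. left_inv_field G x = (\<lambda>g. P g x)"
    and r: "smooth_on (carrier G) r" "\<And>q x. q \<in> carrier G \<Longrightarrow> P q (P (r q) x) = x"
    and D: "determined_by_product G P D"
  shows "agrees_with_std (carrier G) D"
proof -
  interpret P: bounded_bilinear P by (rule P)
  have D1: "linear_connection (carrier G) D"
    and D2: "\<And>x y g. g \<in> carrier G \<Longrightarrow> D (\<lambda>g. P g x) (\<lambda>g. P g y) g = P g (P x y)"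
    using D unfolding determined_by_product_def L by blast+
  show ?thesis
  proof (rule agrees_with_std_if_agrees_on_frame[where I = Basis and E = "\<lambda>b g. P g b", OF U D1])
    show "smooth_on (carrier G) (\<lambda>g. P g b)" for b
      by (rule smooth_on_bounded_linear[OF U P.bounded_linear_left])
    show "D (\<lambda>g. P g a) (\<lambda>g. P g b) p = std_connection (\<lambda>g. P g a) (\<lambda>g. P g b) p"
      if "p \<in> carrier G" for a b p
      unfolding D2[OF that] std_connection_product_fields[OF P] assoc ..
    show "\<exists>c. (\<forall>b\<in>Basis. smooth_on (carrier G) (c b)) \<and>
        (\<forall>q\<in>carrier G. X q = (\<Sum>b\<in>Basis. c b q *\<^sub>R P q b))" if X: "smooth_on (carrier G) X" for X
    proof (intro exI conjI ballI)
      show "smooth_on (carrier G) (\<lambda>q. P (r q) (X q) \<bullet> b)" for b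
        by (rule smooth_on_bounded_linear_comp[OF U bounded_linear_inner_left P.smooth_on_bilinear[OF U r(1) X]])
      show "X q = (\<Sum>b\<in>Basis. (P (r q) (X q) \<bullet> b) *\<^sub>R P q b)" if "q \<in> carrier G" for q
      proof -
        have "X q = P q (\<Sum>b\<in>Basis. (P (r q) (X q) \<bullet> b) *\<^sub>R b)"
          by (simp add: euclidean_representation r(2)[OF that])
        also have "\<dots> = (\<Sum>b\<in>Basis. (P (r q) (X q) \<bullet> b) *\<^sub>R P q b)"
          by (simp add: P.sum_right P.scaleR_right)
        finally show ?thesis .
      qed
    qed
  qed
qed

text \<open>
  Translations of the form constant plus linear preserve the standard connection.
\<close>

lemma flat_bi_invariant_affine_lie_group_if_agrees_with_std:
  fixes G :: "'a::euclidean_space monoid"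
  assumes G: "lie_group G" and D: "linear_connection (carrier G) D" "agrees_with_std (carrier G) D"
    and left: "\<And>g. g \<in> carrier G \<Longrightarrow> \<exists>c L. bounded_linear L \<and> (\<forall>h. g \<otimes>\<^bsub>G\<^esub> h = c + L h)"
    and right: "\<And>g. g \<in> carrier G \<Longrightarrow> \<exists>c L. bounded_linear L \<and> (\<forall>h. h \<otimes>\<^bsub>G\<^esub> g = c + L h)"
  shows "flat_bi_invariant_affine_lie_group G D"
proof -
  from G have group: "group G" and U: "open (carrier G)"
    unfolding lie_group_def by blast+
  interpret group G by (rule group)
  have aff: "affine_map (carrier G) D (carrier G) D F"
    if F: "\<exists>c L. bounded_linear L \<and> (\<forall>h. F h = c + L h)" "F ` carrier G \<subseteq> carrier G" for F
  proof -
    from F(1) obtain c L where "bounded_linear L" "\<forall>h. F h = c + L h" by blast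
    then show ?thesis by (intro affine_map_if_agrees_with_std[OF U U D(2) D(2) _ F(2)]) simp_all
  qed
  have "bi_invariant G D"
    unfolding bi_invariant_def
    by (intro ballI conjI aff left right) auto
  then show ?thesis
    unfolding flat_bi_invariant_affine_lie_group_def
    using G flat_affine_structure_if_agrees_with_std[OF U D] by blast
qed

section \<open>The vector group, the linear group and the affine group as Lie groups\<close>

lemma group_vector_group: "group (vector_group :: (real ^ 'n) monoid)"
  by (rule groupI) (auto simp: vector_group_def add.assoc intro: exI[of _ "- _"] left_minus)

lemma group_GL: "group (GL_group :: ('n::finite) gl monoid)"
proof (rule groupI)
  fix x :: "'n gl" assume "x \<in> carrier GL_group"
  then show "\<exists>y\<in>carrier GL_group. y \<otimes>\<^bsub>GL_group\<^esub> x = \<one>\<^bsub>GL_group\<^esub>"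
    by (auto simp: GL_group_def intro!: bexI[of _ "matrix_inv x"] matrix_inv_left invertible_matrix_inv)
qed (auto simp: GL_group_def invertible_mult matrix_mul_assoc invertible_def[of "mat 1"])

lemma inv_GL: "A \<in> carrier GL_group \<Longrightarrow> inv\<^bsub>GL_group\<^esub> A = matrix_inv A"
  by (rule group.inv_equality[OF group_GL]) (auto simp: GL_group_def matrix_inv_left invertible_matrix_inv)

lemma group_Aff: "group (Aff_group :: ('n::finite) aff monoid)"
proof (rule groupI)
  fix x :: "'n aff" assume x: "x \<in> carrier Aff_group"
  show "\<exists>y\<in>carrier Aff_group. y \<otimes>\<^bsub>Aff_group\<^esub> x = \<one>\<^bsub>Aff_group\<^esub>"
    by (rule bexI[of _ "(- (matrix_inv (snd x) *v fst x), matrix_inv (snd x))"])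
      (use x in \<open>auto simp: Aff_group_def split_beta matrix_inv_left invertible_matrix_inv\<close>)
qed (auto simp: Aff_group_def invertible_mult matrix_mul_assoc matrix_vector_mul_assoc
    matrix_vector_right_distrib add.assoc invertible_def[of "mat 1"])

lemma inv_Aff:
  "x \<in> carrier Aff_group \<Longrightarrow> inv\<^bsub>Aff_group\<^esub> x = (- (matrix_inv (snd x) *v fst x), matrix_inv (snd x))"
  by (rule group.inv_equality[OF group_Aff])
    (auto simp: Aff_group_def split_beta matrix_inv_left invertible_matrix_inv)

lemma carrier_Aff: "carrier Aff_group = {x. invertible (snd x)}"
  by (auto simp: Aff_group_def)

lemma open_carrier_Aff: "open (carrier (Aff_group :: ('n::finite) aff monoid))"
proof -
  have "carrier Aff_group = (snd -` {A. invertible A} :: 'n aff set)" by (auto simp: carrier_Aff)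
  then show ?thesis by (simp only: open_vimage_snd[OF open_invertible])
qed

text \<open>
  The group multiplication differs from the product on the Lie algebra only by the constant that is
  the translation part of the left factor.
\<close>

lemma mult_Aff: "g \<otimes>\<^bsub>Aff_group\<^esub> h = (fst g, 0) + aff_product g h"
  by (simp add: Aff_group_def aff_product_def split_beta)

lemma smooth_on_bilinear_pair:
  assumes "bounded_bilinear B" "open U" "open V"
  shows "smooth_on (U \<times> V) (\<lambda>z. B (fst z) (snd z))"
  by (intro bounded_bilinear.smooth_on_bilinear[OF assms(1)] smooth_on_bounded_linear
      bounded_linear_fst bounded_linear_snd open_Times assms(2,3))

lemma lie_group_vector_group: "lie_group (vector_group :: (real ^ 'n) monoid)"
proof -
  have inv: "inv\<^bsub>vector_group\<^esub> x = - x" for x :: "real ^ 'n"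
    by (rule group.inv_equality[OF group_vector_group]) (simp_all add: vector_group_def)
  have "smooth_on UNIV (\<lambda>z :: (real ^ 'n) \<times> (real ^ 'n). fst z + snd z)"
    by (intro smooth_on_add smooth_on_bounded_linear bounded_linear_fst bounded_linear_snd open_UNIV)
  moreover have "smooth_on UNIV (\<lambda>x :: real ^ 'n. - x)"
    by (intro smooth_on_bounded_linear bounded_linear_minus bounded_linear_ident open_UNIV)
  ultimately show ?thesis
    unfolding lie_group_def inv using group_vector_group by (simp add: vector_group_def split_beta')
qed

lemma lie_group_GL: "lie_group (GL_group :: ('n::finite) gl monoid)"
  unfolding lie_group_def
proof (intro conjI group_GL)
  have carrier: "carrier GL_group = {A :: 'n gl. invertible A}" by (simp add: GL_group_def)
  show op: "open (carrier (GL_group :: 'n gl monoid))" unfolding carrier by (rule open_invertible)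
  show "smooth_on (carrier GL_group \<times> carrier GL_group) (\<lambda>(g, h :: 'n gl). g \<otimes>\<^bsub>GL_group\<^esub> h)"
    using smooth_on_bilinear_pair[OF bounded_bilinear_matrix_mult op op]
    by (simp add: GL_group_def split_beta')
  show "smooth_on (carrier GL_group) (\<lambda>g :: 'n gl. inv\<^bsub>GL_group\<^esub> g)"
    by (rule smooth_on_cong[OF op inv_GL[symmetric]]) (assumption, unfold carrier, rule smooth_on_matrix_inv)
qed

lemma smooth_on_Aff_linear_inv:
  "smooth_on (carrier (Aff_group :: ('n::finite) aff monoid)) (\<lambda>x. matrix_inv (snd x))"
  by (rule smooth_on_comp_bounded_linear[OF open_carrier_Aff open_invertible bounded_linear_snd _ smooth_on_matrix_inv])
    (auto simp: carrier_Aff)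

lemma bounded_linear_pair_left: "bounded_linear (\<lambda>x. (x, 0))"
  by (intro bounded_linear_Pair bounded_linear_ident bounded_linear_zero)

lemma bounded_linear_pair_right: "bounded_linear (\<lambda>x. (0, x))"
  by (intro bounded_linear_Pair bounded_linear_ident bounded_linear_zero)

lemma smooth_on_Aff_section_inv:
  "smooth_on (carrier (Aff_group :: ('n::finite) aff monoid)) (\<lambda>x. (0, matrix_inv (snd x)) :: 'n aff)"
  by (rule smooth_on_bounded_linear_comp[OF open_carrier_Aff bounded_linear_pair_right smooth_on_Aff_linear_inv])

lemma lie_group_Aff: "lie_group (Aff_group :: ('n::finite) aff monoid)"
  unfolding lie_group_def
proof (intro conjI group_Aff open_carrier_Aff)
  let ?U = "carrier (Aff_group :: 'n aff monoid)"
  note op = open_carrier_Aff[where 'n = 'n]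
  note op2 = open_Times[OF op op]
  have "smooth_on (?U \<times> ?U) (\<lambda>z. (fst (fst z), 0) + aff_product (fst z) (snd z))"
    by (intro smooth_on_add op2 smooth_on_bilinear_pair[OF bounded_bilinear_aff_product op op]
        smooth_on_bounded_linear bounded_linear_Pair bounded_linear_zero
        bounded_linear_compose[OF bounded_linear_fst bounded_linear_fst])
  then show "smooth_on (?U \<times> ?U) (\<lambda>(g, h). g \<otimes>\<^bsub>Aff_group\<^esub> h)"
    by (simp add: mult_Aff split_beta')
  \<comment> \<open>both components of the inverse at once: \<open>(0, A\<inverse>) - (A\<inverse> a, 0)\<close>\<close>
  have "smooth_on ?U (\<lambda>x. (0, matrix_inv (snd x)) - aff_product (0, matrix_inv (snd x)) (fst x, 0))"
    by (intro smooth_on_diff op smooth_on_Aff_section_inv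
        bounded_bilinear.smooth_on_bilinear[OF bounded_bilinear_aff_product]
        smooth_on_bounded_linear bounded_linear_Pair bounded_linear_zero bounded_linear_fst)
  then show "smooth_on ?U (\<lambda>x. inv\<^bsub>Aff_group\<^esub> x)"
    by (rule smooth_on_cong[OF op, rotated]) (simp add: inv_Aff aff_product_def)
qed

section \<open>Invariant connections and the split exact sequence\<close>

lemma left_inv_field_GL: "left_inv_field (GL_group :: ('n::finite) gl monoid) x = (\<lambda>g. g ** x)"
proof
  fix g :: "'n gl"
  have "((\<lambda>h. g ** h) has_derivative (\<lambda>v. g ** v)) (at (mat 1))"
    by (rule bounded_linear_imp_has_derivative[OF bounded_bilinear.bounded_linear_right[OF bounded_bilinear_matrix_mult]])
  then show "left_inv_field GL_group x g = g ** x"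
    unfolding left_inv_field_def GL_group_def by (simp add: frechet_derivative_eqI)
qed

lemma left_inv_field_Aff: "left_inv_field (Aff_group :: ('n::finite) aff monoid) x = (\<lambda>g. aff_product g x)"
proof
  fix g :: "'n aff"
  have der: "((\<lambda>h. (fst g, 0) + aff_product g h) has_derivative (\<lambda>v. 0 + aff_product g v)) (at p)" for p
    by (rule has_derivative_add[OF has_derivative_const bounded_linear_imp_has_derivative[OF
        bounded_bilinear.bounded_linear_right[OF bounded_bilinear_aff_product]]])
  show "left_inv_field Aff_group x g = aff_product g x"
    unfolding left_inv_field_def mult_Aff frechet_derivative_eqI[OF der] by simp
qed

lemma agrees_with_std_Aff:
  assumes "determined_by_product Aff_group aff_product D"
  shows "agrees_with_std (carrier Aff_group) D"
proof (rule agrees_with_std_if_determined_by_product[OF open_carrier_Aff bounded_bilinear_aff_product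
      aff_product_assoc left_inv_field_Aff smooth_on_Aff_section_inv _ assms])
  show "aff_product q (aff_product (0, matrix_inv (snd q)) x) = x" if "q \<in> carrier Aff_group" for q x
    using that unfolding carrier_Aff
    by (simp add: aff_product_def split_beta matrix_mul_assoc matrix_vector_mul_assoc matrix_inv_right)
qed

lemma agrees_with_std_GL:
  fixes C :: "('n::finite) gl connection"
  assumes "determined_by_product GL_group (**) C"
  shows "agrees_with_std (carrier GL_group) C"
proof (rule agrees_with_std_if_determined_by_product[OF _ bounded_bilinear_matrix_mult
      matrix_mul_assoc[symmetric] left_inv_field_GL _ _ assms])
  show "open (carrier (GL_group :: 'n gl monoid))" "smooth_on (carrier (GL_group :: 'n gl monoid)) matrix_inv"
    by (simp_all add: GL_group_def open_invertible smooth_on_matrix_inv)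
  show "q ** (matrix_inv q ** x) = x" if "q \<in> carrier GL_group" for q x :: "'n gl"
    using that by (simp add: GL_group_def matrix_mul_assoc matrix_inv_right)
qed

lemma affine_lie_group_vector_group:
  "flat_bi_invariant_affine_lie_group (vector_group :: (real ^ 'n) monoid) std_connection"
  by (rule flat_bi_invariant_affine_lie_group_if_agrees_with_std[OF lie_group_vector_group _ agrees_with_std_std])
    (auto simp: vector_group_def linear_connection_std add.commute intro!: exI[of _ "\<lambda>x. x"] bounded_linear_ident)

lemma affine_lie_group_GL:
  fixes C :: "('n::finite) gl connection"
  assumes "determined_by_product GL_group (**) C"
  shows "flat_bi_invariant_affine_lie_group GL_group C"
proof (rule flat_bi_invariant_affine_lie_group_if_agrees_with_std[OF lie_group_GL _ agrees_with_std_GL[OF assms]])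
  show "linear_connection (carrier GL_group) C"
    using assms unfolding determined_by_product_def by blast
  note mm = bounded_bilinear_matrix_mult[where 'm = 'n and 'n = 'n and 'p = 'n]
  fix g :: "'n gl"
  have "bounded_linear (\<lambda>h :: 'n gl. g ** h) \<and> (\<forall>h. g \<otimes>\<^bsub>GL_group\<^esub> h = 0 + g ** h)"
    by (intro conjI bounded_bilinear.bounded_linear_right[OF mm]) (simp add: GL_group_def)
  then show "\<exists>c L. bounded_linear L \<and> (\<forall>h. g \<otimes>\<^bsub>GL_group\<^esub> h = c + L h)" by blast
  have "bounded_linear (\<lambda>h :: 'n gl. h ** g) \<and> (\<forall>h. h \<otimes>\<^bsub>GL_group\<^esub> g = 0 + h ** g)"
    by (intro conjI bounded_bilinear.bounded_linear_left[OF mm]) (simp add: GL_group_def)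
  then show "\<exists>c L. bounded_linear L \<and> (\<forall>h. h \<otimes>\<^bsub>GL_group\<^esub> g = c + L h)" by blast
qed

lemma affine_lie_group_Aff:
  fixes D :: "('n::finite) aff connection"
  assumes "determined_by_product Aff_group aff_product D"
  shows "flat_bi_invariant_affine_lie_group Aff_group D"
proof (rule flat_bi_invariant_affine_lie_group_if_agrees_with_std[OF lie_group_Aff _ agrees_with_std_Aff[OF assms]])
  show "linear_connection (carrier Aff_group) D"
    using assms unfolding determined_by_product_def by blast
  interpret P: bounded_bilinear "aff_product :: 'n aff \<Rightarrow> 'n aff \<Rightarrow> 'n aff"
    by (rule bounded_bilinear_aff_product)
  fix g :: "'n aff"
  have "bounded_linear (\<lambda>h. aff_product g h) \<and> (\<forall>h. g \<otimes>\<^bsub>Aff_group\<^esub> h = (fst g, 0) + aff_product g h)"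
    by (simp add: mult_Aff P.bounded_linear_right)
  then show "\<exists>c L. bounded_linear L \<and> (\<forall>h. g \<otimes>\<^bsub>Aff_group\<^esub> h = c + L h)" by blast
  have "bounded_linear (\<lambda>h. (fst h, 0) + aff_product h g)"
    by (intro bounded_linear_add bounded_linear_Pair bounded_linear_fst bounded_linear_zero P.bounded_linear_left)
  then have "bounded_linear (\<lambda>h. (fst h, 0) + aff_product h g) \<and>
      (\<forall>h. h \<otimes>\<^bsub>Aff_group\<^esub> g = 0 + ((fst h, 0) + aff_product h g))"
    by (simp add: mult_Aff)
  then show "\<exists>c L. bounded_linear L \<and> (\<forall>h. h \<otimes>\<^bsub>Aff_group\<^esub> g = c + L h)" by blast
qed

text \<open>
  The inclusion, the projection and the section \<open>A \<mapsto> (0, A)\<close> are constant plus linear in the matrix chart: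
  the inclusion has the constant \<open>(0, 1)\<close>, the others are linear.
\<close>

lemma split_exact_Aff:
  fixes D :: "('n::finite) aff connection" and C :: "'n gl connection"
  assumes D: "determined_by_product Aff_group aff_product D" and C: "determined_by_product GL_group (**) C"
  shows "split_exact_affine vector_group std_connection aff_incl Aff_group D aff_proj GL_group C"
proof -
  note agD = agrees_with_std_Aff[OF D] and agC = agrees_with_std_GL[OF C]
  have opN: "open (carrier (vector_group :: (real ^ 'n) monoid))" by (simp add: vector_group_def)
  have opQ: "open (carrier (GL_group :: 'n gl monoid))" by (simp add: GL_group_def open_invertible)
  note opG = open_carrier_Aff
  have inv1: "invertible (mat 1 :: 'n gl)" unfolding invertible_def using matrix_mul_lid by blast
  have incl: "affine_hom vector_group std_connection Aff_group D aff_incl"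
    unfolding affine_hom_def
  proof (intro conjI affine_map_if_agrees_with_std[OF opN opG agrees_with_std_std agD bounded_linear_pair_left])
    show "aff_incl p = (0, mat 1) + (p, 0)" for p :: "real ^ 'n" by (simp add: aff_incl_def)
  qed (auto simp: hom_def aff_incl_def Aff_group_def vector_group_def inv1)
  have proj: "affine_hom Aff_group D GL_group C aff_proj"
    unfolding affine_hom_def
  proof (intro conjI affine_map_if_agrees_with_std[OF opG opQ agD agC bounded_linear_snd])
    show "aff_proj p = 0 + snd p" for p :: "'n aff" by (simp add: aff_proj_def)
  qed (auto simp: hom_def aff_proj_def Aff_group_def GL_group_def)
  have sec: "affine_hom GL_group C Aff_group D (\<lambda>A. (0, A))"
    unfolding affine_hom_def
  proof (intro conjI affine_map_if_agrees_with_std[OF opQ opG agC agD bounded_linear_pair_right])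
    show "(0 :: real ^ 'n, p) = 0 + (0, p)" for p :: "'n gl" by simp
  qed (auto simp: hom_def Aff_group_def GL_group_def)
  have "inj_on aff_incl (carrier (vector_group :: (real ^ 'n) monoid))"
    by (rule inj_onI) (simp add: aff_incl_def)
  moreover have "aff_incl ` carrier (vector_group :: (real ^ 'n) monoid) = kernel Aff_group GL_group aff_proj"
    by (auto simp: aff_incl_def vector_group_def kernel_def Aff_group_def GL_group_def aff_proj_def inv1)
  moreover have "aff_proj ` carrier (Aff_group :: 'n aff monoid) = carrier GL_group"
    by (force simp: Aff_group_def GL_group_def aff_proj_def)
  moreover have "\<exists>s. affine_hom GL_group C Aff_group D s \<and> (\<forall>x\<in>carrier GL_group. aff_proj (s x) = x)"
    using sec by (intro exI[of _ "\<lambda>A. (0, A)"]) (simp add: aff_proj_def)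
  ultimately show ?thesis
    unfolding split_exact_affine_def
    using affine_lie_group_vector_group affine_lie_group_Aff[OF D] affine_lie_group_GL[OF C] incl proj
    by blast
qed

theorem theorem13:
  shows
    "bilinear (aff_product :: ('n::finite) aff \<Rightarrow> 'n aff \<Rightarrow> 'n aff) \<and>
     (\<forall>u v w :: 'n aff. aff_product (aff_product u v) w = aff_product u (aff_product v w)) \<and>
     (\<forall>u v :: 'n aff. aff_product u v - aff_product v u = aff_bracket u v) \<and>
     (\<forall>u v :: 'n aff. aff_bracket u v = lie_algebra_bracket Aff_group u v) \<and>
     (\<exists>D :: 'n aff connection. determined_by_product Aff_group aff_product D) \<and>
     (\<forall>D :: 'n aff connection. determined_by_product Aff_group aff_product D \<longrightarrow>
        flat_affine_structure (carrier Aff_group) D \<and> bi_invariant Aff_group D) \<and>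
     (\<exists>C :: 'n gl connection. determined_by_product GL_group (**) C) \<and>
     (\<forall>(D :: 'n aff connection) (C :: 'n gl connection).
        determined_by_product Aff_group aff_product D \<longrightarrow>
        determined_by_product GL_group (**) C \<longrightarrow>
        split_exact_affine vector_group std_connection aff_incl Aff_group D aff_proj GL_group C)"
proof (intro conjI allI impI)
  show "bilinear (aff_product :: 'n aff \<Rightarrow> 'n aff \<Rightarrow> 'n aff)" by (rule bilinear_aff_product)
  show "aff_product (aff_product u v) w = aff_product u (aff_product v w)" for u v w :: "'n aff"
    by (rule aff_product_assoc)
  show commutator: "aff_product u v - aff_product v u = aff_bracket u v" for u v :: "'n aff"
    by (simp add: aff_product_def aff_bracket_def split_beta)
  have one: "aff_product \<one>\<^bsub>Aff_group\<^esub> u = u" for u :: "'n aff"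
    by (simp add: Aff_group_def aff_product_def split_beta)
  show "aff_bracket u v = lie_algebra_bracket Aff_group u v" for u v :: "'n aff"
    unfolding lie_algebra_bracket_eq_commutator[OF bounded_bilinear_aff_product left_inv_field_Aff one] commutator ..
  show "\<exists>D :: 'n aff connection. determined_by_product Aff_group aff_product D"
    by (rule exI, rule determined_by_product_std[OF open_carrier_Aff bounded_bilinear_aff_product
          aff_product_assoc left_inv_field_Aff])
  show "\<exists>C :: 'n gl connection. determined_by_product GL_group (**) C"
    by (rule exI, rule determined_by_product_std[OF _ bounded_bilinear_matrix_mult
          matrix_mul_assoc[symmetric] left_inv_field_GL])
      (simp add: GL_group_def open_invertible)
  fix D :: "'n aff connection"
  assume D: "determined_by_product Aff_group aff_product D"
  show "flat_affine_structure (carrier Aff_group) D" "bi_invariant Aff_group D"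
    using affine_lie_group_Aff[OF D] unfolding flat_bi_invariant_affine_lie_group_def by blast+
  show "split_exact_affine vector_group std_connection aff_incl Aff_group D aff_proj GL_group C"
    if "determined_by_product GL_group (**) C" for C :: "'n gl connection"
    by (rule split_exact_Aff[OF D that])
qed

end
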